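(* Let $X(z)=\xi_\tau(6+z)$ be the Ramanujan-de Bruijn function. Then for all $z\in\mathbb{C}$, $$X(z)=X(0)\prod_{\Im(z_m)>0}\left(1-\frac{z^2}{z_m^2}\right),$$ where the product runs over all of the zeros $z_m$ of $X$ with $\Im(z_m)>0$.
   Context: The Ramanujan function $\tau(m)$ is defined by $q\prod_{n=1}^\infty(1-q^n)^{24}=\sum_{m=1}^\infty\tau(m)q^m$. The Ramanujan zeta function is $H_\tau(x)=\sum_{\ell=1}^\infty \tau(\ell)\ell^{-x}$ for $\Re(x)>13/2$, and $H_\tau$ also denotes its analytic continuation to $\mathbb{C}$. The Ramanujan-Rankin function $\xi_\tau(x)=(2\pi)^{-x}\Gamma(x)H_\tau(x)$ extends to an entire function of $x\in\mathbb{C}$ (denoted by the same symbol) satisfying $\xi_\tau(x)=\xi_\tau(12-x)$. In products over zeros, each zero is repeated according to its multiplicity. *)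

theory Defs
  imports "HOL-Complex_Analysis.Complex_Analysis"
begin

text \<open>
  The infinite product is taken in the \<open>X\<close>-adic topology of formal power series, so the
  defining identity of the coefficients is read in \<open>\<int>[[X]]\<close>.
\<close>
definition ramanujan_tau :: "nat \<Rightarrow> int" where
  "ramanujan_tau m = fps_nth (fps_X * (\<Prod>n. (1 - fps_X ^ Suc n) ^ 24)) m"

text \<open>
  Both descriptions below determine the function uniquely, by the identity theorem.
  The index \<open>l\<close> is shifted by one: the Dirichlet series runs over \<open>l \<ge> 1\<close>.
\<close>
definition ramanujan_zeta :: "complex \<Rightarrow> complex" where
  "ramanujan_zeta = (THE H. H holomorphic_on UNIV \<and>
     (\<forall>x. Re x > 13 / 2 \<longrightarrow>
        H x = (\<Sum>l. of_int (ramanujan_tau (Suc l)) * of_nat (Suc l) powr (- x))))"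

text \<open>
  The poles of \<open>Gamma\<close> are removable singularities of the product; they have to be left out
  because the library's \<open>Gamma\<close> takes the value \<open>0\<close> there.
\<close>
definition ramanujan_rankin :: "complex \<Rightarrow> complex" where
  "ramanujan_rankin = (THE f. f holomorphic_on UNIV \<and>
     (\<forall>x. x \<notin> \<int>\<^sub>\<le>\<^sub>0 \<longrightarrow>
        f x = of_real (2 * pi) powr (- x) * Gamma x * ramanujan_zeta x))"

definition ramanujan_de_bruijn :: "complex \<Rightarrow> complex" where
  "ramanujan_de_bruijn z = ramanujan_rankin (6 + z)"

text \<open>
  Infinite product over a set without a prescribed order, the multiplicative analogue of
  \<open>has_sum\<close>. As for \<open>has_prod\<close>, only finitely many factors may vanish, and the
  product of the others must converge to a nonzero limit.
\<close>
definition has_prod_over ::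
    "('a \<Rightarrow> 'b :: {t2_space, comm_semiring_1}) \<Rightarrow> 'b \<Rightarrow> 'a set \<Rightarrow> bool" where
  "has_prod_over f p A \<longleftrightarrow>
     finite {a \<in> A. f a = 0} \<and>
     (\<exists>q. q \<noteq> 0 \<and> (prod f \<longlongrightarrow> q) (finite_subsets_at_top {a \<in> A. f a \<noteq> 0}) \<and>
          p = (\<Prod>a \<in> {a \<in> A. f a = 0}. f a) * q)"

text \<open>
  The second component numbers the repetitions, so that a zero of order \<open>m\<close> occurs
  exactly \<open>m\<close> times.
\<close>
definition upper_zeros :: "(complex \<Rightarrow> complex) \<Rightarrow> (complex \<times> nat) set" where
  "upper_zeros f = {(w, k). f w = 0 \<and> Im w > 0 \<and> k < nat (zorder f w)}"

end

theory Submission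
  imports Defs
begin

text \<open>
  With \<open>\<Delta>(q) = q \<Prod>(1 - q\<^sup>n)\<^sup>2\<^sup>4\<close>, the function \<open>X\<close> is the two-sided Laplace transform of the even positive
  kernel \<open>\<Delta>(e\<^bsup>-2\<pi>exp t\<^esup>) e\<^bsup>6t\<^esup>\<close>, so \<open>X(z) = F(z\<^sup>2)\<close> for an entire function \<open>F\<close> with positive Taylor
  coefficients. Hence \<open>X\<close> has no real zeros, \<open>F\<close> has order at most \<open>3/4 < 1\<close>, and Hadamard's
  factorization of \<open>F\<close> is the claimed product. Evenness of the kernel is the modularity of \<open>\<Delta>\<close> on the
  imaginary axis; it comes from the partial fractions of \<open>coth\<close> and a double sum whose two orders of
  summation differ by \<open>(ln y) / 2\<close>. Modularity on the upper half plane gives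
  \<open>\<bar>\<Delta>\<bar> = O(y\<^bsup>-6\<^esup>)\<close>, hence \<open>\<Sum>n\<le>N. \<tau>(n)\<^sup>2 = O(N\<^bsup>12\<^esup>)\<close> and absolute convergence of the Dirichlet series
  for \<open>Re x > 13/2\<close>.
\<close>

section \<open>Hadamard products of order less than one\<close>

text \<open>The bound for \<open>X\<close> is essentially Gamma(6 + |z|), about exp(|z| ln |z|),
  which is order 1. Passing to \<open>F\<close> halves the order, and 3/4 is a convenient exponent
  above 1/2 that absorbs the logarithm. The positive Taylor coefficients enter three times: they
  reduce the growth of \<open>F\<close> to the positive axis, they give
  \<open>F(0) \<noteq> 0\<close>, and they keep the zeros of \<open>F\<close> off [0, \<infinity>),
  so that every zero has exactly one square root in the upper half plane, of the same multiplicity.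

  The obstacle is the description of \<open>ramanujan_zeta\<close>: its series must be shown to
  converge on all of Re x > 13/2. The pointwise estimate |tau(n)| = O(n^6) that follows from the
  bound on \<Delta> would only reach Re x > 7, so the missing half is gained from the mean square.
  That needs \<Delta> near the whole real line, and this is why the inversion law is extended to the
  half plane although the kernel uses it only on the imaginary axis.\<close>

definition zeros_mult :: "(complex \<Rightarrow> complex) \<Rightarrow> (complex \<times> nat) set" where
  "zeros_mult f = {(a, k). f a = 0 \<and> k < nat (zorder f a)}"

definition zeros_mult_ball :: "(complex \<Rightarrow> complex) \<Rightarrow> real \<Rightarrow> (complex \<times> nat) set" where
  "zeros_mult_ball f R = {(a, k) \<in> zeros_mult f. norm a < R}"

definition zeros_prod :: "(complex \<Rightarrow> complex) \<Rightarrow> real \<Rightarrow> complex \<Rightarrow> complex" where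
  "zeros_prod f R z = (\<Prod>(a, k) \<in> zeros_mult_ball f R. 1 - z / a)"

section \<open>Zeros of an entire function in a disc and their removal\<close>

lemma finite_zeros_ball:
  fixes f :: "complex \<Rightarrow> complex"
  assumes "f holomorphic_on UNIV" "f 0 \<noteq> 0"
  shows "finite {a. f a = 0 \<and> norm a < R}"
proof (cases "f constant_on UNIV")
  case True
  then have "{a. f a = 0 \<and> norm a < R} = {}"
    using assms(2) unfolding constant_on_def by (metis (mono_tags, lifting) Collect_empty_eq UNIV_I)
  then show ?thesis by (metis finite.emptyI)
next
  case False
  then have "finite {a \<in> cball 0 R. f a = 0}"
    using assms by (intro holomorphic_compact_finite_zeros[of f UNIV]) auto
  then show ?thesis
    by (rule finite_subset[rotated]) auto
qed

lemma zeros_mult_ball_eq: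
  "zeros_mult_ball f R = (SIGMA a:{a. f a = 0 \<and> norm a < R}. {..<nat (zorder f a)})"
  unfolding zeros_mult_ball_def zeros_mult_def by auto

lemma zeros_mult_ball_mono: "R \<le> S \<Longrightarrow> zeros_mult_ball f R \<subseteq> zeros_mult_ball f S"
  unfolding zeros_mult_ball_def by auto

lemma finite_zeros_mult_ball:
  assumes "f holomorphic_on UNIV" "f 0 \<noteq> 0"
  shows "finite (zeros_mult_ball f R)"
  unfolding zeros_mult_ball_eq using finite_zeros_ball[OF assms] by auto

lemma zeros_prod_eq:
  assumes "f holomorphic_on UNIV" "f 0 \<noteq> 0"
  shows "zeros_prod f R z = (\<Prod>a | f a = 0 \<and> norm a < R. (1 - z / a) ^ nat (zorder f a))"
  unfolding zeros_prod_def zeros_mult_ball_eq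
  using finite_zeros_ball[OF assms] by (subst prod.Sigma [symmetric]) auto

lemma zeros_prod_holomorphic [holomorphic_intros]: "zeros_prod f R holomorphic_on S"
proof -
  have "(\<lambda>z. case x of (a, k) \<Rightarrow> 1 - z / a) holomorphic_on S" for x :: "complex \<times> nat"
    by (cases x) (cases "fst x = 0"; auto intro!: holomorphic_intros)
  then show ?thesis
    unfolding zeros_prod_def by (intro holomorphic_on_prod)
qed

lemma zorder_eq_0I:
  assumes "f holomorphic_on S" "open S" "z \<in> S" "f z \<noteq> 0"
  shows "zorder f z = 0"
  using assms by (intro zorder_eqI[of S _ f]) auto

lemma zorder_prod_linear:
  fixes m :: "complex \<Rightarrow> nat"
  assumes "finite S" "0 \<notin> S" "b \<in> S"
  shows "zorder (\<lambda>z. \<Prod>a\<in>S. (1 - z / a) ^ m a) b = m b"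
proof (rule zorder_eqI)
  let ?g = "\<lambda>z. (- 1 / b) ^ m b * (\<Prod>a\<in>S - {b}. (1 - z / a) ^ m a)"
  have b: "b \<noteq> 0" using assms by auto
  show "?g holomorphic_on UNIV"
    using assms by (auto intro!: holomorphic_intros)
  have "1 - b / a \<noteq> 0" if "a \<in> S - {b}" for a
    using that assms by (auto simp: field_simps)
  then show "?g b \<noteq> 0" using b assms by (auto simp: field_simps)
  fix w assume "w \<noteq> b"
  have "(1 - w / b) ^ m b = ((- 1 / b) * (w - b)) ^ m b"
    using b by (intro arg_cong[where f = "\<lambda>x. x ^ m b"]) (simp add: field_simps)
  then have "(1 - w / b) ^ m b = (- 1 / b) ^ m b * (w - b) ^ m b"
    by (simp only: power_mult_distrib)
  then show "(\<Prod>a\<in>S. (1 - w / a) ^ m a) = ?g w * (w - b) powi int (m b)"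
    using assms by (subst prod.remove[of _ b]) (simp_all add: algebra_simps)
qed auto

text \<open>Two holomorphic functions with the same zeros and the same orders have a zero-free
  holomorphic quotient. Inside the ball \<open>zeros_prod f R\<close> has exactly the zeros of
  \<open>f\<close>, with the orders recorded by the second components of
  \<open>zeros_mult_ball\<close>.\<close>

lemma zeros_prod_factor_ball:
  assumes "f holomorphic_on UNIV" "f 0 \<noteq> 0" "R > 0"
  obtains h where "h holomorphic_on ball 0 R" "\<And>z. norm z < R \<Longrightarrow> h z \<noteq> 0"
    "\<And>z. norm z < R \<Longrightarrow> f z = h z * zeros_prod f R z"
proof (rule holomorphic_zorder_factorization[of f "ball 0 R" "zeros_prod f R"])
  let ?S = "{a. f a = 0 \<and> norm a < R}"
  have fin: "finite ?S" using finite_zeros_ball assms by blast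
  have 0: "0 \<notin> ?S" using assms by auto
  have eq: "zeros_prod f R = (\<lambda>z. \<Prod>a\<in>?S. (1 - z / a) ^ nat (zorder f a))"
    using zeros_prod_eq[OF assms(1,2)] by auto
  have zo: "zorder f a > 0" if "f a = 0" for a
  proof -
    have "\<not> (\<forall>w\<in>UNIV. f w = 0)" using assms by auto
    then show ?thesis
      using zorder_exist_zero[of f UNIV a] assms that by auto
  qed
  show "f holomorphic_on ball 0 R" using assms holomorphic_on_subset by blast
  show z: "zeros_prod f R z = 0 \<longleftrightarrow> f z = 0" if "z \<in> ball 0 R" for z
  proof
    assume "zeros_prod f R z = 0"
    then obtain a where "a \<in> ?S" "(1 - z / a) ^ nat (zorder f a) = 0"
      unfolding eq using fin by auto
    then show "f z = 0" using 0 by (auto simp: field_simps)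
  next
    assume "f z = 0"
    then have "z \<in> ?S" "z \<noteq> 0" "nat (zorder f z) > 0" using that assms zo by auto
    then show "zeros_prod f R z = 0" unfolding eq using fin
      by (intro prod_zero bexI[of _ z]) auto
  qed
  show "zorder (zeros_prod f R) z = zorder f z" if "z \<in> ball 0 R" for z
  proof (cases "f z = 0")
    case True
    then have "zorder (zeros_prod f R) z = int (nat (zorder f z))"
      unfolding eq using fin 0 that by (intro zorder_prod_linear) auto
    then show ?thesis using zo[OF True] by simp
  next
    case False
    then show ?thesis
      using z[OF that] zorder_eq_0I[of f UNIV z] zorder_eq_0I[of "zeros_prod f R" UNIV z] assms
        zeros_prod_holomorphic by auto
  qed
qed (use assms that in \<open>auto intro: zeros_prod_holomorphic\<close>)

text \<open>The quotient has to be estimated on a circle well outside the removed zeros, where the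
  linear factors are large. So the radius \<open>R\<close> of the removed zeros is decoupled from
  the radius \<open>S\<close> of holomorphy: all zeros in the larger disc are divided out, and those
  of modulus at least \<open>R\<close> are multiplied back.\<close>

lemma zeros_prod_factor:
  assumes f: "f holomorphic_on UNIV" "f 0 \<noteq> 0" and R: "0 < R" "R \<le> S"
  obtains h where "h holomorphic_on ball 0 S" "\<And>z. norm z < R \<Longrightarrow> h z \<noteq> 0"
    "\<And>z. norm z < S \<Longrightarrow> f z = h z * zeros_prod f R z"
proof -
  obtain g where g: "g holomorphic_on ball 0 S" "\<And>z. norm z < S \<Longrightarrow> g z \<noteq> 0"
    "\<And>z. norm z < S \<Longrightarrow> f z = g z * zeros_prod f S z"
    using zeros_prod_factor_ball[OF f] R by (metis order_less_le_trans)
  let ?B = "zeros_mult_ball f S - zeros_mult_ball f R"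
  let ?q = "\<lambda>z. \<Prod>(a, k) \<in> ?B. 1 - z / a"
  show thesis
  proof (rule that[of "\<lambda>z. g z * ?q z"])
    have "(\<lambda>z. case x of (a, k) \<Rightarrow> 1 - z / a) holomorphic_on ball 0 S" for x :: "complex \<times> nat"
      by (cases x) (cases "fst x = 0"; auto intro!: holomorphic_intros)
    then show "(\<lambda>z. g z * ?q z) holomorphic_on ball 0 S"
      using g(1) by (intro holomorphic_on_prod holomorphic_intros)
    show "g z * ?q z \<noteq> 0" if "norm z < R" for z
    proof -
      have "1 - z / fst x \<noteq> 0" if "x \<in> ?B" for x
        using that \<open>norm z < R\<close> f by (auto simp: zeros_mult_ball_def field_simps zeros_mult_def)
      then have "?q z \<noteq> 0"
        using finite_zeros_mult_ball[OF f] by (simp add: case_prod_beta prod_zero_iff)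
      then show ?thesis using g(2) that R by auto
    qed
    show "f z = g z * ?q z * zeros_prod f R z" if "norm z < S" for z
    proof -
      have "zeros_prod f S z = ?q z * zeros_prod f R z"
        unfolding zeros_prod_def using R
        by (intro prod.subset_diff zeros_mult_ball_mono finite_zeros_mult_ball f)
      then show ?thesis using g(3)[OF that] by simp
    qed
  qed
qed

lemma prod_norm_ge_power:
  fixes g :: "'a \<Rightarrow> complex" and c :: real
  assumes "\<And>x. x \<in> A \<Longrightarrow> norm (g x) \<ge> c" "c \<ge> 0"
  shows "norm (prod g A) \<ge> c ^ card A"
  unfolding prod_norm [symmetric] prod_constant [symmetric]
  by (intro prod_mono) (use assms in auto)

text \<open>
  On \<open>\<bar>z\<bar> = (c + 1) R\<close> every factor \<open>1 - z / a\<close> with \<open>\<bar>a\<bar> < R\<close> has modulus at least \<open>c\<close>. The case \<open>c = 2\<close>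
  counts zeros, the case \<open>c = 1\<close> bounds the quotient on a disc free of its zeros.
\<close>
lemma zeros_prod_quotient_bound:
  assumes f: "f holomorphic_on UNIV" "f 0 \<noteq> 0" and R: "0 < R" and c: "c \<ge> 1"
    and M: "\<And>z. norm z = (c + 1) * R \<Longrightarrow> norm (f z) \<le> M"
  obtains h where "h holomorphic_on ball 0 ((c + 1) * R)" "\<And>z. norm z < R \<Longrightarrow> h z \<noteq> 0"
    "\<And>z. norm z < (c + 1) * R \<Longrightarrow> f z = h z * zeros_prod f R z" "h 0 = f 0"
    "\<And>z. norm z < (c + 1) * R \<Longrightarrow> norm (h z) * c ^ card (zeros_mult_ball f R) \<le> M"
proof -
  let ?S = "(c + 1) * R" and ?n = "card (zeros_mult_ball f R)"
  have S: "R < ?S" using R c by (simp add: algebra_simps)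
  \<comment> \<open>The extra 1 makes \<open>h\<close> holomorphic on a neighbourhood of the closed
    disc, since the maximum principle on \<open>cball 0 ?S\<close> wants continuity up to the
    circle.\<close>
  obtain h where h: "h holomorphic_on ball 0 (?S + 1)" "\<And>z. norm z < R \<Longrightarrow> h z \<noteq> 0"
    "\<And>z. norm z < ?S + 1 \<Longrightarrow> f z = h z * zeros_prod f R z"
    using zeros_prod_factor[OF f R, of "?S + 1"] S by auto
  have b: "norm (h z) \<le> M / c ^ ?n" if "norm z = ?S" for z
  proof -
    have "c \<le> norm (1 - z / a)" if "(a, k) \<in> zeros_mult_ball f R" for a k
    proof -
      have a: "a \<noteq> 0" "norm a < R"
        using that f by (auto simp: zeros_mult_ball_def zeros_mult_def)
      have "(c + 1) * norm a \<le> norm z"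
        using \<open>norm z = ?S\<close> a c by auto
      then have "c + 1 \<le> norm (z / a)"
        using a by (simp add: norm_divide field_simps)
      also have "\<dots> \<le> norm (1 - z / a) + 1"
        using norm_triangle_ineq4[of "1 - z / a" 1] by simp
      finally show ?thesis by simp
    qed
    then have "c ^ ?n \<le> norm (zeros_prod f R z)"
      unfolding zeros_prod_def using c by (intro prod_norm_ge_power) auto
    then have "norm (h z) * c ^ ?n \<le> norm (f z)"
      using h(3)[of z] that by (simp add: norm_mult mult_left_mono)
    then have "norm (h z) * c ^ ?n \<le> M"
      using M[OF that] by simp
    then show ?thesis using c by (simp add: field_simps)
  qed
  have m: "norm (h z) \<le> M / c ^ ?n" if "norm z < ?S" for z
  proof (rule maximum_modulus_frontier[of h "cball 0 ?S"])
    show "h holomorphic_on interior (cball 0 ?S)"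
      using h(1) by (rule holomorphic_on_subset) auto
    show "continuous_on (closure (cball 0 ?S)) h"
      using h(1) by (intro holomorphic_on_imp_continuous_on holomorphic_on_subset[OF h(1)]) auto
  qed (use b that in auto)
  show thesis
  proof (rule that[of h])
    show "h holomorphic_on ball 0 ?S"
      using h(1) by (rule holomorphic_on_subset) auto
    show "h 0 = f 0" using h(3)[of 0] S R by (simp add: zeros_prod_def)
    show "norm (h z) * c ^ ?n \<le> M" if "norm z < ?S" for z
      using m[OF that] c by (simp add: field_simps)
  qed (use h in auto)
qed

text \<open>A substitute for Jensen's formula: \<open>zeros_prod f R\<close> is 1 at the origin, so
  the quotient there is \<open>f 0\<close>, while each removed zero lowers the bound on the quotient
  by a factor 2.\<close>

lemma card_zeros_mult_ball_bound:
  assumes "f holomorphic_on UNIV" "f 0 \<noteq> 0" "0 < R"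
    and "\<And>z. norm z = 3 * R \<Longrightarrow> norm (f z) \<le> M"
  shows "norm (f 0) * 2 ^ card (zeros_mult_ball f R) \<le> M"
proof -
  have 3: "2 + 1 = (3 :: real)" by simp
  show ?thesis
  proof (rule zeros_prod_quotient_bound[OF assms(1-3), of 2 M, unfolded 3])
    fix h assume "h 0 = f 0"
      "\<And>z. norm z < 3 * R \<Longrightarrow> norm (h z) * 2 ^ card (zeros_mult_ball f R) \<le> M"
    from this(2)[of 0] this(1) assms(3) show ?thesis by simp
  qed (use assms in auto)
qed

text \<open>
  A Borel--Caratheodory estimate: \<open>g / (2 A - g)\<close> maps the disc into itself when \<open>Re g < A\<close>, so the
  Schwarz lemma applies to it.
\<close>
lemma log_bound_of_nonvanishing:
  assumes h: "h holomorphic_on ball 0 R" "\<And>z. norm z < R \<Longrightarrow> h z \<noteq> 0" "h 0 = 1"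
    and A: "A > 0" "\<And>z. norm z < R \<Longrightarrow> norm (h z) < exp A"
    and w: "2 * norm w \<le> R" "R > 0"
  obtains u where "h w = exp u" "norm u \<le> 4 * A * norm w / R"
proof -
  have "\<exists>g. g holomorphic_on ball 0 R \<and> (\<forall>x\<in>ball 0 R. exp (g x) = h x)"
  proof (rule holomorphic_logarithm_exists[of "ball 0 R" h 0])
    show "\<And>x. x \<in> ball 0 R \<Longrightarrow> h x \<noteq> 0" using h(2) by auto
  qed (use h w in auto)
  then obtain g0 where g0: "g0 holomorphic_on ball 0 R" "\<And>x. x \<in> ball 0 R \<Longrightarrow> exp (g0 x) = h x"
    by blast
  define g where "g z = g0 (of_real R * z) - g0 0" for z
  have Rz: "of_real R * z \<in> ball 0 R" if "norm z < 1" for z :: complex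
    using that w by (simp add: norm_mult)
  have exp_g: "exp (g z) = h (of_real R * z)" if "norm z < 1" for z
    unfolding g_def using g0(2)[OF Rz[OF that]] g0(2)[of 0] w h(3) by (simp add: exp_diff)
  have hg: "g holomorphic_on ball 0 1"
    unfolding g_def
    by (intro holomorphic_intros holomorphic_on_compose_gen[OF _ g0(1), unfolded o_def])
      (use Rz in auto)
  have Re: "Re (g z) < A" if "norm z < 1" for z
  proof -
    have "exp (Re (g z)) < exp A"
      using A(2)[of "of_real R * z"] Rz[OF that] exp_g[OF that] norm_exp_eq_Re[of "g z"] by auto
    then show ?thesis by simp
  qed
  \<comment> \<open>The real part is larger than \<open>A\<close>, which is positive.\<close>
  have nz: "2 * of_real A - g z \<noteq> 0" if "norm z < 1" for z
    using Re[OF that] A by (auto dest!: arg_cong[where f = Re])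
  define \<phi> where "\<phi> z = g z / (2 * of_real A - g z)" for z
  have S: "norm (\<phi> z) \<le> norm z" if "norm z < 1" for z
  proof (rule Schwarz_Lemma(1)[of \<phi>])
    show "\<phi> holomorphic_on ball 0 1"
      unfolding \<phi>_def using hg nz by (intro holomorphic_intros) auto
    show "\<phi> 0 = 0" by (simp add: \<phi>_def g_def)
    show "norm (\<phi> z) < 1" if "norm z < 1" for z
    proof -
      have "norm (g z) ^ 2 < norm (2 * of_real A - g z) ^ 2"
      proof -
        have "norm (2 * of_real A - g z) ^ 2 - norm (g z) ^ 2 = 4 * A * (A - Re (g z))"
          unfolding cmod_power2 by (simp add: power2_eq_square algebra_simps)
        also have "\<dots> > 0" using A Re[OF that] by auto
        finally show ?thesis by simp
      qed
      then have "norm (g z) < norm (2 * of_real A - g z)"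
        by (rule power_less_imp_less_base) auto
      then show ?thesis unfolding \<phi>_def norm_divide by (subst divide_less_eq_1) auto
    qed
  qed (use that in auto)
  let ?z = "w / of_real R"
  have z: "norm ?z \<le> 1 / 2" using w by (simp add: norm_divide field_simps)
  have "norm (g ?z) \<le> norm ?z * norm (2 * of_real A - g ?z)"
  proof -
    have "norm ?z < 1" using z by linarith
    from S[OF this] nz[OF this] show ?thesis
      by (simp add: \<phi>_def norm_divide pos_divide_le_eq)
  qed
  also have "\<dots> \<le> norm ?z * (2 * A + norm (g ?z))"
    using A norm_triangle_ineq4[of "2 * of_real A" "g ?z"] by (intro mult_left_mono) auto
  \<comment> \<open>As \<open>norm ?z\<close> is at most 1/2, half of \<open>norm (g ?z)\<close> can
    be moved to the left, which doubles \<open>2 * A\<close> to the constant 4 of the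
    statement.\<close>
  also have "\<dots> \<le> 2 * A * norm ?z + 1 / 2 * norm (g ?z)"
    using z mult_right_mono[OF z, of "norm (g ?z)"] by (simp add: algebra_simps)
  finally have "norm (g ?z) \<le> 4 * A * norm ?z" by simp
  then show thesis
    using that[of "g ?z"] exp_g[of ?z] z w by (simp add: norm_divide)
qed

section \<open>Unordered infinite products\<close>

lemma summable_on_norm_ge_finite:
  fixes g :: "'a \<Rightarrow> real"
  assumes "g summable_on A" "\<And>x. x \<in> A \<Longrightarrow> g x \<ge> 0" "e > 0"
  shows "finite {x \<in> A. g x \<ge> e}"
proof (rule finite_if_finite_subsets_card_bdd[THEN conjunct1])
  fix F assume F: "F \<subseteq> {x \<in> A. e \<le> g x}" "finite F"
  have "e * card F \<le> sum g F"
    using F sum_mono[of F "\<lambda>_. e" g] by (auto simp: mult.commute)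
  also have "\<dots> \<le> infsum g A"
    using F assms by (intro finite_sum_le_infsum) auto
  finally have "real (card F) \<le> infsum g A / e" using assms(3) by (simp add: field_simps)
  then show "card F \<le> nat \<lceil>infsum g A / e\<rceil>" by linarith
qed

text \<open>The product is the exponential of the sum of principal logarithms, so the limit cannot
  vanish, and the branch does not matter after exponentiation. The logarithms are summable because
  \<open>norm (Ln (1 + u)) \<le> 2 * norm u\<close> for \<open>norm u\<close> below 1/2; the
  finitely many larger terms are put aside.\<close>

lemma prod_one_plus_tendsto:
  fixes g :: "'a \<Rightarrow> complex"
  assumes g: "(\<lambda>x. norm (g x)) summable_on A" and nz: "\<And>x. x \<in> A \<Longrightarrow> 1 + g x \<noteq> 0"
  shows "\<exists>q. q \<noteq> 0 \<and> (prod (\<lambda>x. 1 + g x) \<longlongrightarrow> q) (finite_subsets_at_top A)"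
proof -
  define B where "B = {x \<in> A. norm (g x) \<ge> 1 / 2}"
  have B: "finite B" unfolding B_def using g by (intro summable_on_norm_ge_finite) auto
  have "(\<lambda>x. norm (Ln (1 + g x))) summable_on (A - B)"
  proof (rule summable_on_comparison_test)
    show "(\<lambda>x. 2 * norm (g x)) summable_on (A - B)"
      using g by (intro summable_on_cmult_right) (rule summable_on_subset_banach[OF g], auto)
    show "norm (Ln (1 + g x)) \<le> 2 * norm (g x)" if "x \<in> A - B" for x
      using that norm_Ln_le[of "g x"] by (auto simp: B_def)
  qed auto
  then have "(\<lambda>x. Ln (1 + g x)) summable_on (A - B)"
    by (rule abs_summable_summable)
  then have "(\<lambda>x. Ln (1 + g x)) summable_on (A - B) \<union> B"
    using B by (intro summable_on_Un_disjoint) auto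
  moreover have "(A - B) \<union> B = A" by (auto simp: B_def)
  ultimately obtain s where "((\<lambda>x. Ln (1 + g x)) has_sum s) A"
    by (auto simp: summable_on_def)
  then have "((\<lambda>F. exp (\<Sum>x\<in>F. Ln (1 + g x))) \<longlongrightarrow> exp s) (finite_subsets_at_top A)"
    unfolding has_sum_def by (rule tendsto_exp)
  moreover have "\<forall>\<^sub>F F in finite_subsets_at_top A. exp (\<Sum>x\<in>F. Ln (1 + g x)) = (\<Prod>x\<in>F. 1 + g x)"
    by (rule eventually_finite_subsets_at_top_weakI)
      (use nz in \<open>auto simp: exp_sum intro!: prod.cong\<close>)
  ultimately have "(prod (\<lambda>x. 1 + g x) \<longlongrightarrow> exp s) (finite_subsets_at_top A)"
    by (rule Lim_transform_eventually)
  then show ?thesis by (intro exI[of _ "exp s"]) auto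
qed

lemma has_prod_over_reindex:
  assumes "bij_betw h A B"
  shows "has_prod_over f p B \<longleftrightarrow> has_prod_over (\<lambda>x. f (h x)) p A"
proof -
  have inj: "inj_on h A" and B: "B = h ` A" using assms by (auto simp: bij_betw_def)
  have eq: "{b \<in> B. P (f b)} = h ` {a \<in> A. P (f (h a))}" for P using B by auto
  have inj': "inj_on h {a \<in> A. P (f (h a))}" for P using inj by (auto simp: inj_on_def)
  have "finite {b \<in> B. f b = 0} \<longleftrightarrow> finite {a \<in> A. f (h a) = 0}"
    unfolding eq[of "\<lambda>x. x = 0"] using inj'[of "\<lambda>x. x = 0"] by (rule finite_image_iff)
  moreover have "(\<Prod>b\<in>{b \<in> B. f b = 0}. f b) = (\<Prod>a\<in>{a \<in> A. f (h a) = 0}. f (h a))"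
    unfolding eq[of "\<lambda>x. x = 0"] using inj'[of "\<lambda>x. x = 0"] by (simp add: prod.reindex)
  moreover have "(prod f \<longlongrightarrow> q) (finite_subsets_at_top {b \<in> B. f b \<noteq> 0}) \<longleftrightarrow>
      (prod (\<lambda>x. f (h x)) \<longlongrightarrow> q) (finite_subsets_at_top {a \<in> A. f (h a) \<noteq> 0})" for q
  proof -
    let ?A = "{a \<in> A. f (h a) \<noteq> 0}"
    have i: "inj_on h ?A" by (rule inj'[of "\<lambda>x. x \<noteq> 0"])
    have "(prod f \<longlongrightarrow> q) (finite_subsets_at_top {b \<in> B. f b \<noteq> 0}) \<longleftrightarrow>
       (prod f \<longlongrightarrow> q) (filtermap (image h) (finite_subsets_at_top ?A))"
      unfolding eq[of "\<lambda>x. x \<noteq> 0"] filtermap_image_finite_subsets_at_top[OF i] ..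
    also have "\<dots> \<longleftrightarrow> ((\<lambda>F. prod f (h ` F)) \<longlongrightarrow> q) (finite_subsets_at_top ?A)"
      by (simp add: filterlim_filtermap)
    also have "\<dots> \<longleftrightarrow> (prod (\<lambda>x. f (h x)) \<longlongrightarrow> q) (finite_subsets_at_top ?A)"
    proof (rule filterlim_cong[OF refl refl])
      show "\<forall>\<^sub>F F in finite_subsets_at_top ?A. prod f (h ` F) = (\<Prod>x\<in>F. f (h x))"
        by (rule eventually_finite_subsets_at_top_weakI)
          (use i in \<open>auto simp: prod.reindex[OF inj_on_subset]\<close>)
    qed
    finally show ?thesis .
  qed
  ultimately show ?thesis unfolding has_prod_over_def by simp
qed

text \<open>A growth exponent below one rules out both convergence factors and an exponential factor
  in Hadamard's theorem. The summand 1 in \<open>1 + norm z\<close> lets one constant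
  \<open>C\<close> serve small and large \<open>z\<close> alike.\<close>

locale genus_zero =
  fixes f :: "complex \<Rightarrow> complex" and C \<rho> :: real
  assumes holo: "f holomorphic_on UNIV" and f0: "f 0 \<noteq> 0"
    and \<rho>: "0 \<le> \<rho>" "\<rho> < 1" and C: "C \<ge> 0"
    and growth: "\<And>z. norm (f z) \<le> exp (C * (1 + norm z) powr \<rho>)"
begin

text \<open>Convergence along discs is obtained together with its value, before any summability of
  the zeros: the quotient of \<open>f w / f 0\<close> by the product over the disc of radius
  \<open>n\<close> is \<open>exp u\<close>, and the Borel--Caratheodory estimate gives |u| =
  O(n^\<rho> |w| / n). This tends to 0 since \<rho> < 1.\<close>

lemma zeros_prod_tendsto: "(\<lambda>n. zeros_prod f (real n) w) \<longlonglongrightarrow> f w / f 0"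
proof -
  \<comment> \<open>\<open>A n\<close> is the exponent of the growth bound on the circle of radius
    \<open>2 * n\<close>, plus room for the division by \<open>f 0\<close>; the final 1 makes it
    positive and the bound strict.\<close>
  define A where "A n = C * (1 + 2 * real n) powr \<rho> + \<bar>ln (norm (f 0))\<bar> + 1" for n
  have A: "A n > 0" for n unfolding A_def using C by (smt (verit) mult_nonneg_nonneg powr_ge_zero)
  have "\<exists>u. f w = f 0 * exp u * zeros_prod f (real n) w \<and> norm u \<le> 4 * A n * norm w / real n"
    if n: "n > 0" "2 * norm w \<le> real n" for n
  proof -
    have 2: "1 + 1 = (2 :: real)" by simp
    have "norm (f z) \<le> exp (C * (1 + 2 * real n) powr \<rho>)" if "norm z = 2 * real n" for z
      using growth[of z] that by simp
    then obtain h where h: "h holomorphic_on ball 0 (2 * real n)" "\<And>z. norm z < real n \<Longrightarrow> h z \<noteq> 0"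
      "\<And>z. norm z < 2 * real n \<Longrightarrow> f z = h z * zeros_prod f (real n) z" "h 0 = f 0"
      "\<And>z. norm z < 2 * real n \<Longrightarrow> norm (h z) \<le> exp (C * (1 + 2 * real n) powr \<rho>)"
      using zeros_prod_quotient_bound[OF holo f0, of "real n" 1 "exp (C * (1 + 2 * real n) powr \<rho>)"] n
      unfolding 2 by auto
    obtain u where "h w / f 0 = exp u" "norm u \<le> 4 * A n * norm w / real n"
    proof (rule log_bound_of_nonvanishing[of "\<lambda>z. h z / f 0" "real n" "A n" w])
      show "(\<lambda>z. h z / f 0) holomorphic_on ball 0 (real n)"
        using f0 by (intro holomorphic_intros holomorphic_on_subset[OF h(1)]) auto
      show "norm (h z / f 0) < exp (A n)" if "norm z < real n" for z
      proof -
        have "norm (h z / f 0) \<le> exp (C * (1 + 2 * real n) powr \<rho>) / exp (ln (norm (f 0)))"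
          using h(5)[of z] that f0 by (simp add: norm_divide divide_right_mono)
        also have "\<dots> < exp (A n)"
          unfolding exp_diff [symmetric] A_def by (subst exp_less_cancel_iff) linarith
        finally show ?thesis .
      qed
      show "h z / f 0 \<noteq> 0" if "norm z < real n" for z using h(2)[OF that] f0 by simp
      show "h 0 / f 0 = 1" using h(4) f0 by simp
    qed (use n A that in simp_all)
    moreover from this(1) have "h w = f 0 * exp u" using f0 by (simp add: field_simps)
    moreover have "norm w < 2 * real n" using n by linarith
    ultimately show ?thesis using h(3)[of w] by auto
  qed
  then obtain u where u: "\<And>n. n > 0 \<Longrightarrow> 2 * norm w \<le> real n \<Longrightarrow>
     f w = f 0 * exp (u n) * zeros_prod f (real n) w \<and> norm (u n) \<le> 4 * A n * norm w / real n"
    by metis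
  obtain N :: nat where "max 1 (2 * norm w) < real N"
    using reals_Archimedean2 by blast
  then have N: "N > 0" "2 * norm w \<le> real N" by simp_all
  have ev: "\<forall>\<^sub>F n in sequentially. n > 0 \<and> 2 * norm w \<le> real n"
    using N by (intro eventually_sequentiallyI[of N]) (auto intro: order_trans)
  have "(\<lambda>n. 4 * A n * norm w / real n) \<longlonglongrightarrow> 0"
  proof -
    have "(\<lambda>n. (1 + 2 * real n) powr \<rho> / real n) \<longlonglongrightarrow> 0"
    proof (rule Lim_null_comparison)
      show "(\<lambda>n. 3 powr \<rho> * real n powr (\<rho> - 1)) \<longlonglongrightarrow> 0"
        using \<rho> by (intro tendsto_mult_right_zero tendsto_neg_powr filterlim_real_sequentially) auto
      show "\<forall>\<^sub>F n in sequentially. norm ((1 + 2 * real n) powr \<rho> / real n) \<le> 3 powr \<rho> * real n powr (\<rho> - 1)"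
      proof (rule eventually_sequentiallyI[of 1])
        fix n :: nat assume "1 \<le> n"
        then have "(1 + 2 * real n) powr \<rho> \<le> (3 * real n) powr \<rho>"
          using \<rho> by (intro powr_mono2) auto
        then show "norm ((1 + 2 * real n) powr \<rho> / real n) \<le> 3 powr \<rho> * real n powr (\<rho> - 1)"
          using \<open>1 \<le> n\<close> by (simp add: powr_mult powr_diff divide_right_mono)
      qed
    qed
    then have "(\<lambda>n. 4 * norm w * (C * ((1 + 2 * real n) powr \<rho> / real n) +
        (\<bar>ln (norm (f 0))\<bar> + 1) / real n)) \<longlonglongrightarrow> 4 * norm w * (C * 0 + 0)"
      by (intro tendsto_intros lim_const_over_n)
    then show ?thesis unfolding A_def by (simp add: field_simps add_divide_distrib)
  qed
  then have "u \<longlonglongrightarrow> 0"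
    by (rule Lim_null_comparison[rotated]) (rule eventually_mono[OF ev], use u in blast)
  then have "(\<lambda>n. f w / (f 0 * exp (u n))) \<longlonglongrightarrow> f w / (f 0 * exp 0)"
    using f0 by (intro tendsto_intros) auto
  then have "(\<lambda>n. zeros_prod f (real n) w) \<longlonglongrightarrow> f w / (f 0 * exp 0)"
  proof (rule Lim_transform_eventually, intro eventually_mono[OF ev])
    fix n assume "0 < n \<and> 2 * norm w \<le> real n"
    then show "f w / (f 0 * exp (u n)) = zeros_prod f (real n) w"
      using u[of n] f0 by (auto simp: field_simps)
  qed
  then show ?thesis by simp
qed

lemma card_zeros_bound:
  "\<exists>K\<ge>0. \<forall>R>0. real (card (zeros_mult_ball f R)) \<le> K * (1 + R) powr \<rho>"
proof (intro exI[of _ "(C * 3 powr \<rho> + \<bar>ln (norm (f 0))\<bar>) / ln 2"] conjI allI impI)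
  fix R :: real assume R: "R > 0"
  let ?n = "card (zeros_mult_ball f R)"
  have "norm (f 0) * 2 ^ ?n \<le> exp (C * (1 + 3 * R) powr \<rho>)"
    using growth R by (intro card_zeros_mult_ball_bound holo f0) (metis R)+
  then have "ln (norm (f 0) * 2 ^ ?n) \<le> ln (exp (C * (1 + 3 * R) powr \<rho>))"
    using f0 by (subst ln_le_cancel_iff) auto
  then have "real ?n * ln 2 \<le> C * (1 + 3 * R) powr \<rho> + \<bar>ln (norm (f 0))\<bar>"
    using f0 by (simp add: ln_mult ln_realpow)
  \<comment> \<open>Here \<open>1 + 3 * R \<le> 3 * (1 + R)\<close>, and
    \<open>(1 + R) powr \<rho> \<ge> 1\<close> absorbs the logarithm of
    \<open>norm (f 0)\<close>.\<close>
  also have "\<dots> \<le> C * (3 * (1 + R)) powr \<rho> + \<bar>ln (norm (f 0))\<bar> * (1 + R) powr \<rho>"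
    using R C \<rho> by (intro add_mono mult_left_mono powr_mono2 mult_le_cancel_left1[THEN iffD2])
      (auto intro!: ge_one_powr_ge_zero)
  also have "\<dots> = (C * 3 powr \<rho> + \<bar>ln (norm (f 0))\<bar>) * (1 + R) powr \<rho>"
    using R by (subst powr_mult) (auto simp: algebra_simps)
  finally show "real ?n \<le> (C * 3 powr \<rho> + \<bar>ln (norm (f 0))\<bar>) / ln 2 * (1 + R) powr \<rho>"
    by (simp add: field_simps)
qed (use C in auto)

text \<open>Dyadic shells: at most a constant times 2^(\<rho> J) zeros have modulus near 2^J, so a
  shell contributes a constant multiple of \<open>r ^ J\<close> with
  \<open>r = 2 powr (\<rho> - 1)\<close>, and \<rho> < 1 makes the series geometric.\<close>

lemma zeros_summable: "(\<lambda>x. 1 / norm (fst x)) summable_on zeros_mult f"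
proof -
  obtain K where K: "K \<ge> 0" "\<And>R. R > 0 \<Longrightarrow> real (card (zeros_mult_ball f R)) \<le> K * (1 + R) powr \<rho>"
    using card_zeros_bound by blast
  let ?B = "\<lambda>J. zeros_mult_ball f (2 ^ J)" and ?g = "\<lambda>x. 1 / norm (fst x :: complex)"
  define r where "r = 2 powr (\<rho> - 1)"
  have r: "0 < r" "r < 1" using \<rho> by (auto simp: r_def powr_less_one)
  have fin: "finite (?B J)" for J using finite_zeros_mult_ball[OF holo f0] .
  have bd: "sum ?g (?B J) \<le> sum ?g (?B 0) + (\<Sum>j<J. 4 * K * r ^ j)" for J
  proof (induction J)
    case (Suc J)
    have "sum ?g (?B (Suc J)) = sum ?g (?B J) + sum ?g (?B (Suc J) - ?B J)"
      by (subst add.commute, intro sum.subset_diff fin zeros_mult_ball_mono) auto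
    also have "sum ?g (?B (Suc J) - ?B J) \<le> (\<Sum>x\<in>?B (Suc J) - ?B J. 1 / 2 ^ J)"
    proof (intro sum_mono)
      fix x assume "x \<in> ?B (Suc J) - ?B J"
      then have "2 ^ J \<le> norm (fst x)" by (auto simp: zeros_mult_ball_def)
      then show "1 / norm (fst x) \<le> 1 / 2 ^ J" by (intro divide_left_mono) (auto intro!: mult_pos_pos intro: less_le_trans[of _ "2 ^ J"])
    qed
    also have "\<dots> \<le> real (card (?B (Suc J))) / 2 ^ J"
      using card_mono[OF fin, of "?B (Suc J) - ?B J" "Suc J"] by (simp add: divide_right_mono)
    also have "\<dots> \<le> K * (1 + 2 ^ Suc J) powr \<rho> / 2 ^ J"
      by (intro divide_right_mono K) auto
    also have "\<dots> \<le> K * (4 * 2 powr J) powr \<rho> / 2 ^ J"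
    proof -
      have "(1 :: real) \<le> 2 ^ J" by simp
      then have "1 + 2 ^ Suc J \<le> 4 * 2 powr real J" unfolding power_Suc powr_realpow[OF zero_less_numeral] by linarith
      then show ?thesis using K \<rho> by (intro divide_right_mono mult_left_mono powr_mono2) auto
    qed
    also have "\<dots> = K * 4 powr \<rho> * r ^ J"
    proof -
      have "r ^ J = 2 powr ((\<rho> - 1) * J)"
        unfolding r_def by (simp add: powr_realpow [symmetric] powr_powr)
      also have "\<dots> = (2 powr J) powr \<rho> / 2 ^ J"
        unfolding powr_powr left_diff_distrib powr_diff by (simp add: powr_realpow mult.commute)
      finally show ?thesis by (simp add: powr_mult)
    qed
    also have "\<dots> \<le> K * 4 * r ^ J"
      using K \<rho> r powr_mono[of \<rho> 1 4] by (intro mult_right_mono mult_left_mono) auto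
    finally show ?case using Suc by (simp add: mult_ac)
  qed auto
  show ?thesis
  proof (rule nonneg_bdd_above_summable_on)
    show "bdd_above (sum ?g ` {F. F \<subseteq> zeros_mult f \<and> finite F})"
    proof (rule bdd_aboveI2)
      fix F assume F: "F \<in> {F. F \<subseteq> zeros_mult f \<and> finite F}"
      define m where "m = Max (insert 0 ((\<lambda>x. norm (fst x)) ` F))"
      obtain J where J: "m < 2 ^ J" using real_arch_pow[of 2 m] by auto
      have "F \<subseteq> ?B J"
      proof
        fix x assume x: "x \<in> F"
        then have "norm (fst x) \<le> m" unfolding m_def using F by (intro Max_ge) auto
        then show "x \<in> ?B J" using J x F by (auto simp: zeros_mult_ball_def)
      qed
      then have "sum ?g F \<le> sum ?g (?B J)" using fin by (intro sum_mono2) auto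
      also have "\<dots> \<le> sum ?g (?B 0) + (\<Sum>j<J. 4 * K * r ^ j)" by (rule bd)
      also have "(\<Sum>j<J. 4 * K * r ^ j) \<le> (\<Sum>j. 4 * K * r ^ j)"
        using r K by (intro sum_le_suminf summable_mult summable_geometric) auto
      finally show "sum ?g F \<le> sum ?g (?B 0) + (\<Sum>j. 4 * K * r ^ j)" by simp
    qed
  qed auto
qed

text \<open>Absolute summability provides an unordered limit, and the limit along discs provides its
  value, because the discs exhaust the zeros. At a zero of \<open>f\<close> no limit has to be
  identified: the vanishing factor makes both sides 0.\<close>

theorem hadamard_product: "has_prod_over (\<lambda>(a, k). 1 - w / a) (f w / f 0) (zeros_mult f)"
proof -
  let ?g = "\<lambda>x :: complex \<times> nat. case x of (a, k) \<Rightarrow> 1 - w / a"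
  let ?Z = "{x \<in> zeros_mult f. ?g x = 0}" and ?N = "{x \<in> zeros_mult f. ?g x \<noteq> 0}"
  have fin: "finite ?Z"
  proof (rule finite_subset)
    show "?Z \<subseteq> zeros_mult_ball f (norm w + 1)"
      by (auto simp: zeros_mult_ball_def field_simps split: if_splits)
    show "finite (zeros_mult_ball f (norm w + 1))" using finite_zeros_mult_ball[OF holo f0] .
  qed
  have "(\<lambda>x. norm (- w / fst x)) summable_on ?N"
  proof -
    have "(\<lambda>x. norm w * (1 / norm (fst x))) summable_on ?N"
      by (intro summable_on_cmult_right summable_on_subset_banach[OF zeros_summable]) auto
    then show ?thesis by (simp add: norm_divide)
  qed
  from prod_one_plus_tendsto[OF this] obtain q where q: "q \<noteq> 0"
    "(prod (\<lambda>x. 1 + - w / fst x) \<longlongrightarrow> q) (finite_subsets_at_top ?N)"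
    by auto
  have q': "(prod ?g \<longlongrightarrow> q) (finite_subsets_at_top ?N)"
    using q(2) by (simp add: case_prod_beta)
  have "f w / f 0 = prod ?g ?Z * q"
  proof (cases "f w = 0")
    case True
    then have "zorder f w > 0"
      using zorder_exist_zero[of f UNIV w] holo f0 by auto
    then have "(w, 0) \<in> ?Z" using True f0 by (auto simp: zeros_mult_def)
    then have "prod ?g ?Z = 0" using fin by (intro prod_zero bexI[of _ "(w, 0)"]) auto
    then show ?thesis using True by simp
  next
    case False
    have Z: "?Z = {}" using False by (auto simp: zeros_mult_def field_simps split: if_splits)
    then have N: "?N = zeros_mult f" by blast
    have "filterlim (\<lambda>n. zeros_mult_ball f (real n)) (finite_subsets_at_top (zeros_mult f)) sequentially"
      unfolding filterlim_finite_subsets_at_top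
    proof safe
      fix X assume X: "finite X" "X \<subseteq> zeros_mult f"
      define m where "m = Max (insert 0 ((\<lambda>x. norm (fst x)) ` X))"
      obtain n0 :: nat where n0: "m < n0" using reals_Archimedean2 by blast
      show "\<forall>\<^sub>F n in sequentially. finite (zeros_mult_ball f (real n)) \<and>
          X \<subseteq> zeros_mult_ball f (real n) \<and> zeros_mult_ball f (real n) \<subseteq> zeros_mult f"
      proof (rule eventually_sequentiallyI[of n0], intro conjI subsetI)
        fix n x assume n: "n0 \<le> n" and x: "x \<in> X"
        then have "norm (fst x) \<le> m" unfolding m_def using X by (intro Max_ge) auto
        then show "x \<in> zeros_mult_ball f (real n)"
          using n n0 x X by (auto simp: zeros_mult_ball_def)
      qed (use finite_zeros_mult_ball[OF holo f0] in \<open>auto simp: zeros_mult_ball_def\<close>)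
    qed
    from filterlim_compose[OF q'[unfolded N] this]
    have "(\<lambda>n. zeros_prod f (real n) w) \<longlonglongrightarrow> q" by (simp add: zeros_prod_def)
    with zeros_prod_tendsto have "f w / f 0 = q" by (rule LIMSEQ_unique)
    then show ?thesis unfolding Z by simp
  qed
  then show ?thesis unfolding has_prod_over_def using fin q(1) q'
    by (intro conjI exI[of _ q])
qed

end

section \<open>Zeros of a function composed with squaring\<close>

lemma zorder_compose_square:
  assumes "f holomorphic_on UNIV" "f 0 \<noteq> 0" "w \<noteq> 0"
  shows "zorder (\<lambda>z. f (z\<^sup>2)) w = zorder f (w\<^sup>2)"
proof -
  have an: "f analytic_on {w\<^sup>2}"
    using assms(1) analytic_on_open analytic_on_subset by (metis open_UNIV subset_UNIV)
  have "\<forall>\<^sub>F z in at (w\<^sup>2). f z \<noteq> 0"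
    using non_zero_neighbour_alt[of f UNIV "w\<^sup>2" 0] assms by (auto elim: eventually_mono)
  \<comment> \<open>Squaring separates \<open>w\<close> from the points near it, because the second
    root \<open>- w\<close> is a different point.\<close>
  moreover have "\<forall>\<^sub>F z in at w. z\<^sup>2 \<noteq> w\<^sup>2"
  proof -
    have "w \<noteq> - w" using assms(3) by (simp add: eq_neg_iff_add_eq_0)
    then have "\<forall>\<^sub>F z in at w. z \<noteq> - w"
      by (intro tendsto_imp_eventually_ne[OF tendsto_ident_at])
    moreover have "\<forall>\<^sub>F z in at w. z \<noteq> w" by (simp add: eventually_at_filter)
    ultimately show ?thesis by eventually_elim (auto simp: power2_eq_iff)
  qed
  moreover have "zorder (\<lambda>x. x\<^sup>2 - w\<^sup>2) w = 1"
  proof (rule zorder_eqI[of UNIV])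
    show "x\<^sup>2 - w\<^sup>2 = (x + w) * (x - w) powi 1" for x
      by (simp add: power2_eq_square algebra_simps)
  qed (use assms in \<open>auto intro!: holomorphic_intros\<close>)
  moreover have "isolated_singularity_at f (w\<^sup>2)" "not_essential f (w\<^sup>2)"
    using an isolated_singularity_at_analytic not_essential_analytic by blast+
  moreover have "(\<lambda>z. z\<^sup>2) analytic_on {w}" by (intro analytic_intros)
  ultimately show ?thesis
    using zorder_compose'[of f "\<lambda>z. z\<^sup>2" w] by (simp add: o_def)
qed

text \<open>Squaring maps the upper half plane bijectively onto the complement of [0, \<infinity>)
  and preserves orders there, and by \<open>pos\<close> no zero of \<open>f\<close> lies on [0,
  \<infinity>). So the zeros of the composition in the upper half plane, numbered with multiplicity,
  correspond one to one to all zeros of \<open>f\<close>.\<close>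

theorem (in genus_zero) hadamard_product_even:
  assumes pos: "\<And>x. x \<in> \<real> \<Longrightarrow> f (x\<^sup>2) \<noteq> 0"
  shows "has_prod_over (\<lambda>(w, k). 1 - z\<^sup>2 / w\<^sup>2) (f (z\<^sup>2) / f 0) (upper_zeros (\<lambda>z. f (z\<^sup>2)))"
proof -
  have "bij_betw (\<lambda>(w, k). (w\<^sup>2, k)) (upper_zeros (\<lambda>z. f (z\<^sup>2))) (zeros_mult f)"
  proof (rule bij_betwI')
    fix x y assume "x \<in> upper_zeros (\<lambda>z. f (z\<^sup>2))" "y \<in> upper_zeros (\<lambda>z. f (z\<^sup>2))"
    then show "((case x of (w, k) \<Rightarrow> (w\<^sup>2, k)) = (case y of (w, k) \<Rightarrow> (w\<^sup>2, k))) = (x = y)"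
      by (auto simp: upper_zeros_def power2_eq_iff)
  next
    fix x assume "x \<in> upper_zeros (\<lambda>z. f (z\<^sup>2))"
    then show "(case x of (w, k) \<Rightarrow> (w\<^sup>2, k)) \<in> zeros_mult f"
      using zorder_compose_square[OF holo f0, of "fst x"]
      by (cases "fst x = 0") (auto simp: upper_zeros_def zeros_mult_def)
  next
    fix y assume y: "y \<in> zeros_mult f"
    obtain a k where [simp]: "y = (a, k)" by (cases y)
    define v where "v = csqrt a"
    have v: "v\<^sup>2 = a" by (simp add: v_def)
    have "Im v \<noteq> 0"
    proof
      assume "Im v = 0"
      then have "v \<in> \<real>" by (simp add: complex_is_Real_iff)
      then show False using pos[of v] v y by (auto simp: zeros_mult_def)
    qed
    define w where "w = (if Im v > 0 then v else - v)"
    have w: "Im w > 0" "w\<^sup>2 = a" using \<open>Im v \<noteq> 0\<close> v by (auto simp: w_def)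
    then have "w \<noteq> 0" by auto
    then have "(w, k) \<in> upper_zeros (\<lambda>z. f (z\<^sup>2))"
      using zorder_compose_square[OF holo f0, of w] w y
      by (auto simp: upper_zeros_def zeros_mult_def)
    then show "\<exists>x\<in>upper_zeros (\<lambda>z. f (z\<^sup>2)). y = (case x of (w, k) \<Rightarrow> (w\<^sup>2, k))"
      using w by (intro bexI[of _ "(w, k)"]) auto
  qed
  from has_prod_over_reindex[OF this, of "\<lambda>(a, k). 1 - z\<^sup>2 / a"] hadamard_product[of "z\<^sup>2"]
  show ?thesis by (simp add: case_prod_unfold)
qed

section \<open>Inversion of the Lambert series\<close>

text \<open>The logarithmic derivative of the reflection formula. It is taken with
  \<open>rGamma\<close>, whose product with its reflection is the entire function sin(pi z) /
  pi.\<close>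

lemma Digamma_reflection:
  fixes z :: complex
  assumes "z \<notin> \<int>"
  shows "Digamma (1 - z) - Digamma z = of_real pi * cot (of_real pi * z)"
proof -
  have z: "z \<notin> \<int>\<^sub>\<le>\<^sub>0" "1 - z \<notin> \<int>\<^sub>\<le>\<^sub>0"
  proof -
    show "z \<notin> \<int>\<^sub>\<le>\<^sub>0" using assms nonpos_Ints_Int by blast
    show "1 - z \<notin> \<int>\<^sub>\<le>\<^sub>0" using assms nonpos_Ints_Int[of "1 - z"] Ints_diff[OF Ints_1, of "1 - z"] by auto
  qed
  have "((\<lambda>z. rGamma z * rGamma (1 - z)) has_field_derivative
      (- rGamma z * Digamma z) * rGamma (1 - z) + (rGamma (1 - z) * Digamma (1 - z)) * rGamma z) (at z)"
    using z by (auto intro!: derivative_eq_intros simp: algebra_simps)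
  moreover have "((\<lambda>z :: complex. sin (of_real pi * z) / of_real pi) has_field_derivative
      cos (of_real pi * z)) (at z)"
    by (auto intro!: derivative_eq_intros)
  moreover have "(\<lambda>z :: complex. rGamma z * rGamma (1 - z)) = (\<lambda>z. sin (of_real pi * z) / of_real pi)"
    by (rule ext) (rule rGamma_reflection_complex)
  ultimately have "(- rGamma z * Digamma z) * rGamma (1 - z) + (rGamma (1 - z) * Digamma (1 - z)) * rGamma z
     = cos (of_real pi * z)"
    using DERIV_unique by metis
  then have "(Digamma (1 - z) - Digamma z) * (rGamma z * rGamma (1 - z)) = cos (of_real pi * z)"
    by (simp add: algebra_simps)
  then have "(Digamma (1 - z) - Digamma z) * sin (of_real pi * z) = of_real pi * cos (of_real pi * z)"
    unfolding rGamma_reflection_complex by (simp add: field_simps)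
  moreover have "sin (of_real pi * z) \<noteq> 0"
  proof
    assume "sin (of_real pi * z) = 0"
    then have "rGamma z * rGamma (1 - z) = 0" by (simp add: rGamma_reflection_complex)
    then show False using z by (simp add: rGamma_eq_zero_iff)
  qed
  ultimately show ?thesis by (simp add: cot_def field_simps)
qed

text \<open>In the difference of the two limits for \<open>Digamma\<close> the logarithms cancel.
  They pair \<open>n\<close> with \<open>- (n + 1)\<close>, which is not yet the symmetric
  pairing.\<close>

lemma cot_partial_fractions:
  fixes z :: complex
  assumes "z \<notin> \<int>"
  shows "(\<lambda>m. \<Sum>n<m. inverse (z + of_nat n) + inverse (z - of_nat (Suc n))) \<longlonglongrightarrow> of_real pi * cot (of_real pi * z)"
proof -
  have z: "z \<noteq> 0" "1 - z \<noteq> 0" using assms by auto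
  have "(\<lambda>m. (of_real (ln (real m)) - (\<Sum>n<m. inverse (1 - z + of_nat n))) -
     (of_real (ln (real m)) - (\<Sum>n<m. inverse (z + of_nat n)))) \<longlonglongrightarrow> Digamma (1 - z) - Digamma z"
    using z by (intro tendsto_diff Digamma_LIMSEQ)
  moreover have "inverse (z - of_nat (Suc n)) = - inverse (1 - z + of_nat n)" for n
    by (simp flip: inverse_minus_eq add: algebra_simps)
  ultimately show ?thesis
    using Digamma_reflection[OF assms] by (simp add: sum_subtractf)
qed

text \<open>The cotangent series on the imaginary axis: at \<open>\<i> * x\<close> the cotangent
  becomes coth(pi x) = 1 + 2 / (exp(2 pi x) - 1) up to a factor, and the term 1/z of the series
  accounts for the last summand on the right.\<close>

lemma inverse_exp_minus_one_partial_fractions: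
  fixes x :: real
  assumes x: "x > 0"
  shows "(\<lambda>k. 1 / (x\<^sup>2 + (real (Suc k))\<^sup>2)) sums
    (pi / x * (1 / (exp (2 * pi * x) - 1) + 1 / 2 - 1 / (2 * pi * x)))"
proof -
  define z :: complex where "z = \<i> * of_real x"
  have "z \<notin> \<int>" using x by (auto simp: z_def Ints_def complex_eq_iff)
  have z0: "z \<noteq> 0" using x by (auto simp: z_def)
  have 1: "z + of_nat n \<noteq> 0" "z - of_nat n \<noteq> 0" for n
    using x by (auto simp: z_def complex_eq_iff)
  \<comment> \<open>Shifting from the pairing of \<open>n\<close> with \<open>- (n + 1)\<close> to
    that of \<open>n + 1\<close> with \<open>- (n + 1)\<close> splits off the first term
    \<open>inverse z\<close> and a last term that tends to 0.\<close>
  have s: "(\<Sum>n<m. inverse (z + of_nat n) + inverse (z - of_nat (Suc n))) =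
     inverse z - inverse (z + of_nat m) + (\<Sum>n<m. 2 * z / (z\<^sup>2 - (of_nat (Suc n))\<^sup>2))" for m
  proof (induction m)
    case (Suc m)
    have e: "inverse (z - of_nat (Suc m)) = 2 * z / (z\<^sup>2 - (of_nat (Suc m))\<^sup>2) - inverse (z + of_nat (Suc m))"
    proof -
      have "z\<^sup>2 - (of_nat (Suc m))\<^sup>2 = (z + of_nat (Suc m)) * (z - of_nat (Suc m))"
        by (simp add: power2_eq_square algebra_simps)
      then show ?thesis using 1[of "Suc m"] by (simp add: divide_simps del: of_nat_Suc)
    qed
    show ?case by (simp only: sum.lessThan_Suc Suc.IH e) simp
  qed simp
  have z2: "2 * z / (z\<^sup>2 - (of_nat (Suc n))\<^sup>2) = - (\<i> * of_real (2 * x * (1 / (x\<^sup>2 + (real (Suc n))\<^sup>2))))" for n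
  proof -
    have e: "z\<^sup>2 - (of_nat (Suc n))\<^sup>2 = - of_real (x\<^sup>2 + (real (Suc n))\<^sup>2)"
      by (simp add: z_def power_mult_distrib)
    show ?thesis unfolding e divide_minus_right by (simp add: z_def)
  qed
  have "(\<lambda>m. inverse (z + of_nat m)) \<longlonglongrightarrow> 0"
    by (intro filterlim_compose[OF tendsto_inverse_0] tendsto_add_filterlim_at_infinity[OF tendsto_const] tendsto_of_nat)
  then have "(\<lambda>m. (\<Sum>n<m. inverse (z + of_nat n) + inverse (z - of_nat (Suc n))) - inverse z + inverse (z + of_nat m))
     \<longlonglongrightarrow> of_real pi * cot (of_real pi * z) - inverse z + 0"
    by (intro tendsto_intros cot_partial_fractions \<open>z \<notin> \<int>\<close>)
  then have "(\<lambda>m. \<Sum>n<m. - (\<i> * of_real (2 * x * (1 / (x\<^sup>2 + (real (Suc n))\<^sup>2)))))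
     \<longlonglongrightarrow> of_real pi * cot (of_real pi * z) - inverse z"
    unfolding s z2 by simp
  then have lim: "(\<lambda>m. - Im (\<Sum>n<m. - (\<i> * of_real (2 * x * (1 / (x\<^sup>2 + (real (Suc n))\<^sup>2))))) / (2 * x))
     \<longlonglongrightarrow> - Im (of_real pi * cot (of_real pi * z) - inverse z) / (2 * x)"
    using x by (intro tendsto_intros) auto
  have *: "(\<lambda>k. 1 / (x\<^sup>2 + (real (Suc k))\<^sup>2)) sums (- Im (of_real pi * cot (of_real pi * z) - inverse z) / (2 * x))"
  proof -
    have "- Im (\<Sum>n<m. - (\<i> * of_real (2 * x * (1 / (x\<^sup>2 + (real (Suc n))\<^sup>2))))) =
        2 * x * (\<Sum>n<m. 1 / (x\<^sup>2 + (real (Suc n))\<^sup>2))" for m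
      by (simp add: sum_negf sum_distrib_left del: of_nat_Suc)
    then have "- Im (\<Sum>n<m. - (\<i> * of_real (2 * x * (1 / (x\<^sup>2 + (real (Suc n))\<^sup>2))))) / (2 * x) =
        (\<Sum>n<m. 1 / (x\<^sup>2 + (real (Suc n))\<^sup>2))" for m using x by (simp del: of_nat_Suc)
    then show ?thesis using lim unfolding sums_def by (simp only:)
  qed
  have e: "exp (2 * pi * x) > 1" using x by simp
  have "cot (of_real pi * z) = - \<i> * of_real ((exp (2 * pi * x) + 1) / (exp (2 * pi * x) - 1))"
  proof -
    have frac: "(a + b) / 2 / ((a - b) / (2 * \<i>)) = \<i> * ((a + b) / (a - b))" for a b
      by (cases "a = b") (auto simp: field_simps)
    have "\<i> * (of_real pi * z) = of_real (- (pi * x))" by (simp add: z_def complex_eq_iff)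
    moreover have "- (\<i> * (of_real pi * z)) = of_real (pi * x)" by (simp add: z_def complex_eq_iff)
    ultimately have "cot (of_real pi * z) = \<i> * of_real ((exp (- (pi * x)) + exp (pi * x)) / (exp (- (pi * x)) - exp (pi * x)))"
      unfolding cot_def sin_exp_eq cos_exp_eq by (simp only: exp_of_real frac) simp
    also have "(exp (- (pi * x)) + exp (pi * x)) / (exp (- (pi * x)) - exp (pi * x)) =
       - ((exp (2 * pi * x) + 1) / (exp (2 * pi * x) - 1))"
    proof -
      define E where "E = exp (pi * x)"
      have E: "E > 1" "exp (2 * pi * x) = E * E" using x by (auto simp: E_def simp flip: exp_add)
      have "E * E > 1" using E(1) by (simp add: less_1_mult)
      then show ?thesis unfolding E(2) exp_minus E_def[symmetric] using E(1)
        by (simp add: divide_simps) (simp add: algebra_simps)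
    qed
    finally show ?thesis by simp
  qed
  then have im: "Im (of_real pi * cot (of_real pi * z) - inverse z) =
     - (pi * ((exp (2 * pi * x) + 1) / (exp (2 * pi * x) - 1))) + 1 / x"
    using x by (simp add: z_def inverse_eq_divide Im_divide power2_eq_square)
  have "- (- (pi * ((E + 1) / (E - 1))) + 1 / x) / (2 * x) = pi / x * (1 / (E - 1) + 1 / 2 - 1 / (2 * pi * x))"
    if "E > 1" for E
    using that x by (simp add: field_simps)
  from *[unfolded im this[OF e]] show ?thesis .
qed

section \<open>The inverse tangent integral\<close>

lemma arctan_ge: "u \<ge> 0 \<Longrightarrow> u / (1 + u\<^sup>2) \<le> arctan u"
proof -
  assume u: "u \<ge> 0"
  have "(\<lambda>u. arctan u - u / (1 + u\<^sup>2)) 0 \<le> (\<lambda>u. arctan u - u / (1 + u\<^sup>2)) u"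
  proof (rule DERIV_nonneg_imp_nondecreasing[OF u], intro exI conjI)
    fix x :: real assume "0 \<le> x" "x \<le> u"
    have p: "1 + x\<^sup>2 > 0" by (simp add: add_pos_nonneg)
    have "((\<lambda>u. arctan u - u / (1 + u\<^sup>2)) has_real_derivative
       inverse (1 + x\<^sup>2) - (1 * (1 + x\<^sup>2) - x * (2 * x)) / ((1 + x\<^sup>2) * (1 + x\<^sup>2))) (at x)"
      using p by (intro DERIV_diff DERIV_divide DERIV_arctan DERIV_ident) (auto intro!: derivative_eq_intros)
    also have "inverse (1 + x\<^sup>2) - (1 * (1 + x\<^sup>2) - x * (2 * x)) / ((1 + x\<^sup>2) * (1 + x\<^sup>2)) = 2 * x\<^sup>2 / (1 + x\<^sup>2)\<^sup>2"
      using p by (simp add: divide_simps power2_eq_square)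
    finally show "((\<lambda>u. arctan u - u / (1 + u\<^sup>2)) has_real_derivative 2 * x\<^sup>2 / (1 + x\<^sup>2)\<^sup>2) (at x)" .
    show "0 \<le> 2 * x\<^sup>2 / (1 + x\<^sup>2)\<^sup>2" by simp
  qed
  then show ?thesis by simp
qed

definition arctan_quot :: "real \<Rightarrow> real" where
  "arctan_quot u = (if u = 0 then 1 else arctan u / u)"

text \<open>The function usually written Ti_2. It will appear as the limit of Riemann sums of step y
  / M.\<close>

definition arctan_int :: "real \<Rightarrow> real" where
  "arctan_int y = integral {0..y} arctan_quot"

lemma arctan_quot_continuous: "continuous_on S arctan_quot"
proof -
  have "isCont arctan_quot x" for x
  proof (cases "x = 0")
    case True
    have "(arctan has_real_derivative 1) (at 0)"
      by (auto intro!: derivative_eq_intros)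
    then have "((\<lambda>u. arctan u / u) \<longlongrightarrow> 1) (at 0)"
      by (simp add: DERIV_def)
    then have "(arctan_quot \<longlongrightarrow> 1) (at 0)"
      by (rule Lim_transform_eventually) (auto simp: arctan_quot_def eventually_at_filter)
    then show ?thesis using True by (simp add: isCont_def arctan_quot_def)
  next
    case False
    then have "isCont (\<lambda>u. arctan u / u) x" by (intro continuous_intros)
    moreover have "\<forall>\<^sub>F u in nhds x. arctan u / u = arctan_quot u"
      using t1_space_nhds[OF False] by eventually_elim (simp add: arctan_quot_def)
    ultimately show ?thesis using isCont_cong by force
  qed
  then show ?thesis by (rule continuous_at_imp_continuous_on[rule_format])
qed

text \<open>The derivative of arctan(u) / u has the sign of u / (1 + u^2) - arctan u. Monotonicity
  is what compares the Riemann sums with the integral.\<close>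

lemma arctan_quot_antimono:
  assumes "0 \<le> u" "u \<le> v"
  shows "arctan_quot v \<le> arctan_quot u"
proof -
  have le: "arctan_quot v \<le> 1" if "v \<ge> 0" for v
    using that arctan_le_self[of v] by (auto simp: arctan_quot_def divide_simps)
  have "arctan v / v \<le> arctan u / u" if "u > 0"
  proof (rule DERIV_nonpos_imp_nonincreasing[OF assms(2)], intro exI conjI)
    fix x assume "u \<le> x" "x \<le> v"
    then have x: "x > 0" using that by simp
    show "((\<lambda>u. arctan u / u) has_real_derivative (x / (1 + x\<^sup>2) - arctan x) / x\<^sup>2) (at x)"
      using x by (auto intro!: derivative_eq_intros simp: field_simps power2_eq_square)
    show "(x / (1 + x\<^sup>2) - arctan x) / x\<^sup>2 \<le> 0"
      using arctan_ge[of x] x by (simp add: divide_nonpos_nonneg)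
  qed
  then show ?thesis using assms le[of v] by (auto simp: arctan_quot_def)
qed

lemma arctan_int_diff:
  assumes "0 \<le> a" "a \<le> b"
  shows "(arctan_quot has_integral (arctan_int b - arctan_int a)) {a..b}"
proof -
  have "arctan_quot integrable_on {0..b}"
    by (intro integrable_continuous_real arctan_quot_continuous)
  then have "integral {0..a} arctan_quot + integral {a..b} arctan_quot = integral {0..b} arctan_quot"
    using assms by (intro Henstock_Kurzweil_Integration.integral_combine)
  then have "arctan_int b - arctan_int a = integral {a..b} arctan_quot"
    unfolding arctan_int_def by linarith
  moreover have "(arctan_quot has_integral integral {a..b} arctan_quot) {a..b}"
    by (intro integrable_integral integrable_continuous_real arctan_quot_continuous)
  ultimately show ?thesis by simp
qed

lemma arctan_int_increment:
  assumes "0 \<le> a" "a \<le> b"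
  shows "(b - a) * arctan_quot b \<le> arctan_int b - arctan_int a"
    "arctan_int b - arctan_int a \<le> (b - a) * arctan_quot a"
proof -
  have c: "((\<lambda>_. c) has_integral (b - a) * c) {a..b}" for c :: real
    using has_integral_const_real[of c a b] assms by simp
  show "(b - a) * arctan_quot b \<le> arctan_int b - arctan_int a"
    by (rule has_integral_le[OF c arctan_int_diff[OF assms]]) (use assms in \<open>auto intro!: arctan_quot_antimono\<close>)
  show "arctan_int b - arctan_int a \<le> (b - a) * arctan_quot a"
    by (rule has_integral_le[OF arctan_int_diff[OF assms] c]) (use assms in \<open>auto intro!: arctan_quot_antimono\<close>)
qed

lemma arctan_int_0 [simp]: "arctan_int 0 = 0"
  by (simp add: arctan_int_def)

lemma arctan_int_deriv:
  assumes "y > 0"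
  shows "(arctan_int has_real_derivative arctan y / y) (at y)"
proof -
  have "(arctan_int has_real_derivative arctan_quot y) (at y within {0..y + 1})"
    unfolding arctan_int_def using assms
    by (intro integral_has_real_derivative arctan_quot_continuous) auto
  moreover have "at y within {0..y + 1} = at y"
    using assms by (intro at_within_interior) auto
  ultimately show ?thesis using assms by (simp add: arctan_quot_def)
qed

text \<open>Since arctan x + arctan(1/x) = pi/2, the left side has derivative pi / (2 y), and both
  sides vanish at y = 1. This logarithm is the source of the factor \<open>y ^ 12\<close> in the
  modularity of \<Delta>.\<close>

lemma arctan_int_inverse:
  assumes "y > 0"
  shows "arctan_int y - arctan_int (1 / y) = pi / 2 * ln y"
proof -
  define K where "K y = arctan_int y - arctan_int (1 / y) - pi / 2 * ln y" for y
  have "(K has_real_derivative 0) (at x)" if "x > 0" for x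
  proof -
    have "((\<lambda>y. arctan_int (1 / y)) has_real_derivative arctan (1 / x) / (1 / x) * (- 1 / x\<^sup>2)) (at x)"
      using that by (intro DERIV_chain2[OF arctan_int_deriv])
        (auto intro!: derivative_eq_intros simp: power2_eq_square)
    then have "(K has_real_derivative arctan x / x - arctan (1 / x) / (1 / x) * (- 1 / x\<^sup>2) - pi / 2 * (1 / x)) (at x)"
      unfolding K_def using that by (auto intro!: derivative_eq_intros arctan_int_deriv)
    moreover have "arctan x / x - arctan (1 / x) / (1 / x) * (- 1 / x\<^sup>2) - pi / 2 * (1 / x) = 0"
      using that arctan_inverse[of x] by (simp add: field_simps power2_eq_square)
    ultimately show ?thesis by simp
  qed
  then have "\<exists>c. \<forall>x\<in>{0<..}. K x = c"
    by (intro has_field_derivative_zero_constant) (auto intro: has_field_derivative_at_within)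
  then have "K y = K 1" using assms by auto
  then show ?thesis by (simp add: K_def)
qed

text \<open>
  Comparison of \<open>\<Sum>k>M. a / (a\<^sup>2 + k\<^sup>2)\<close> with the telescoping sum of the increments of
  \<open>arctan (a / t)\<close>.
\<close>
lemma arctan_tail_bounds:
  assumes a: "a > 0" and M: "M > 0"
  shows "(\<Sum>k. a / (a\<^sup>2 + (real (Suc (k + M)))\<^sup>2)) \<le> arctan (a / M)"
    "arctan (a / Suc M) \<le> (\<Sum>k. a / (a\<^sup>2 + (real (Suc (k + M)))\<^sup>2))"
    "summable (\<lambda>k. a / (a\<^sup>2 + (real (Suc (k + M)))\<^sup>2))"
proof -
  have inc: "a / (a\<^sup>2 + (real (Suc k))\<^sup>2) \<le> arctan (a / k) - arctan (a / Suc k)"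
     "arctan (a / k) - arctan (a / Suc k) \<le> a / (a\<^sup>2 + (real k)\<^sup>2)" if k: "k > 0" for k :: nat
  proof -
    have der: "((\<lambda>t. arctan (a / t)) has_real_derivative - (a / (a\<^sup>2 + x\<^sup>2))) (at x)" if "x > 0" for x
    proof -
      have "a\<^sup>2 + x\<^sup>2 > 0" using that by (simp add: add_nonneg_pos)
      then show ?thesis using that a
        by (auto intro!: derivative_eq_intros simp: power2_eq_square divide_simps)
    qed
    obtain x where x: "real k < x" "x < real (Suc k)"
      "arctan (a / Suc k) - arctan (a / k) = (real (Suc k) - real k) * - (a / (a\<^sup>2 + x\<^sup>2))"
      using MVT2[of "real k" "real (Suc k)" "\<lambda>t. arctan (a / t)" "\<lambda>x. - (a / (a\<^sup>2 + x\<^sup>2))"] der k by force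
    have "a / (a\<^sup>2 + (real (Suc k))\<^sup>2) \<le> a / (a\<^sup>2 + x\<^sup>2)"
      using x a k by (intro divide_left_mono add_left_mono power_mono mult_pos_pos add_pos_pos) auto
    then show "a / (a\<^sup>2 + (real (Suc k))\<^sup>2) \<le> arctan (a / k) - arctan (a / Suc k)"
      using x(3) by simp
    have "a / (a\<^sup>2 + x\<^sup>2) \<le> a / (a\<^sup>2 + (real k)\<^sup>2)"
      using x a k by (intro divide_left_mono add_left_mono power_mono mult_pos_pos add_pos_pos) auto
    then show "arctan (a / k) - arctan (a / Suc k) \<le> a / (a\<^sup>2 + (real k)\<^sup>2)"
      using x(3) by simp
  qed
  have lim: "(\<lambda>n. arctan (a / real n)) \<longlonglongrightarrow> 0"
    using tendsto_arctan[OF lim_const_over_n[of a]] by simp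
  have tel: "(\<lambda>k. arctan (a / (k + N)) - arctan (a / (Suc (k + N)))) sums arctan (a / N)" for N :: nat
    using telescope_sums'[of "\<lambda>k. arctan (a / (k + N))" 0] LIMSEQ_ignore_initial_segment[OF lim, of N]
    by simp
  show sm: "summable (\<lambda>k. a / (a\<^sup>2 + (real (Suc (k + M)))\<^sup>2))"
    by (rule summable_comparison_test'[OF sums_summable[OF tel[of M]], of 0])
      (use inc(1) M a in \<open>auto simp del: of_nat_Suc of_nat_add\<close>)
  show "(\<Sum>k. a / (a\<^sup>2 + (real (Suc (k + M)))\<^sup>2)) \<le> arctan (a / M)"
    by (intro sums_le[OF _ summable_sums[OF sm] tel] inc(1)) (use M in simp)
  show "arctan (a / Suc M) \<le> (\<Sum>k. a / (a\<^sup>2 + (real (Suc (k + M)))\<^sup>2))"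
    using M inc(2)[of "Suc (_ + M)"] by (intro sums_le[OF _ tel summable_sums[OF sm]]) auto
qed

text \<open>In the double series over \<open>m\<close> and \<open>k\<close> of y / ((m y)^2 + k^2)
  this is the strip m \<le> M < k. The square m, k \<le> M turns into itself when \<open>y\<close>
  is replaced by \<open>1 / y\<close> and the indices are exchanged, so the strip carries the effect
  of the order of summation.\<close>

definition mixed_tail :: "real \<Rightarrow> nat \<Rightarrow> real" where
  "mixed_tail y M = (\<Sum>m=1..M. \<Sum>k. y / ((real m * y)\<^sup>2 + (real (Suc (k + M)))\<^sup>2))"

text \<open>For each \<open>m\<close> the tail over \<open>k\<close> lies between arctan(m y / (M +
  1)) / m and arctan(m y / M) / m. The upper bounds form a right endpoint sum of
  \<open>arctan_quot\<close> with step \<open>y / M\<close>, the lower ones a left endpoint sum with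
  step \<open>y / Suc M\<close> that begins at \<open>y / Suc M\<close>; hence the term subtracted
  on the left.\<close>

lemma mixed_tail_bounds:
  assumes y: "y > 0" and M: "M > 0"
  shows "mixed_tail y M \<le> arctan_int y" "arctan_int y - arctan_int (y / Suc M) \<le> mixed_tail y M"
proof -
  have eq: "(\<Sum>k. y / ((real m * y)\<^sup>2 + (real (Suc (k + M)))\<^sup>2)) =
      (\<Sum>k. (real m * y) / ((real m * y)\<^sup>2 + (real (Suc (k + M)))\<^sup>2)) / m" if "m \<in> {1..M}" for m
    using that M y by (subst suminf_divide[symmetric]) (auto intro!: arctan_tail_bounds simp del: of_nat_Suc)
  have "mixed_tail y M \<le> (\<Sum>m=1..M. arctan_int (m * (y / M)) - arctan_int ((real m - 1) * (y / M)))"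
    unfolding mixed_tail_def
  proof (intro sum_mono)
    fix m assume m: "m \<in> {1..M}"
    have "(\<Sum>k. y / ((real m * y)\<^sup>2 + (real (Suc (k + M)))\<^sup>2)) \<le> arctan (real m * y / M) / m"
      unfolding eq[OF m] using m y M by (intro divide_right_mono arctan_tail_bounds) auto
    also have "\<dots> = (m * (y / M) - (real m - 1) * (y / M)) * arctan_quot (m * (y / M))"
      using m y M by (simp add: arctan_quot_def field_simps)
    also have "\<dots> \<le> arctan_int (m * (y / M)) - arctan_int ((real m - 1) * (y / M))"
      using m y M by (intro arctan_int_increment mult_right_mono) auto
    finally show "(\<Sum>k. y / ((real m * y)\<^sup>2 + (real (Suc (k + M)))\<^sup>2)) \<le>
      arctan_int (m * (y / M)) - arctan_int ((real m - 1) * (y / M))" .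
  qed
  also have "\<dots> = arctan_int (M * (y / M)) - arctan_int 0"
    using sum_telescope''[of 0 M "\<lambda>m. arctan_int (m * (y / M))"]
    by (simp add: of_nat_diff flip: atLeastSucAtMost_greaterThanAtMost)
  finally show "mixed_tail y M \<le> arctan_int y" using M by simp
  let ?h = "y / Suc M"
  have "arctan_int y - arctan_int ?h = arctan_int (Suc M * ?h) - arctan_int (1 * ?h)"
    by (simp del: of_nat_Suc)
  also have "\<dots> = (\<Sum>m=1..M. arctan_int (Suc m * ?h) - arctan_int (m * ?h))"
    using sum_Suc_diff[of 1 M "\<lambda>m. arctan_int (m * ?h)"] M by simp
  also have "\<dots> \<le> mixed_tail y M"
    unfolding mixed_tail_def
  proof (intro sum_mono)
    fix m assume m: "m \<in> {1..M}"
    have "arctan_int (Suc m * ?h) - arctan_int (m * ?h) \<le> (Suc m * ?h - m * ?h) * arctan_quot (m * ?h)"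
      using m y by (intro arctan_int_increment mult_right_mono) auto
    also have "\<dots> = arctan (real m * y / Suc M) / m"
    proof -
      have "Suc m * ?h - m * ?h = ?h" by (simp add: algebra_simps add_divide_distrib)
      moreover have "arctan_quot (m * ?h) = arctan (m * ?h) / (m * ?h)"
        using m y by (simp add: arctan_quot_def)
      moreover have "?h * (arctan (m * ?h) / (m * ?h)) = arctan (m * ?h) / m"
        using m y by (simp del: of_nat_Suc)
      ultimately show ?thesis by (simp del: of_nat_Suc)
    qed
    also have "\<dots> \<le> (\<Sum>k. y / ((real m * y)\<^sup>2 + (real (Suc (k + M)))\<^sup>2))"
      unfolding eq[OF m] using m y M by (intro divide_right_mono arctan_tail_bounds) auto
    finally show "arctan_int (Suc m * ?h) - arctan_int (m * ?h) \<le> (\<Sum>k. y / ((real m * y)\<^sup>2 + (real (Suc (k + M)))\<^sup>2))" .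
  qed
  finally show "arctan_int y - arctan_int ?h \<le> mixed_tail y M" .
qed

lemma mixed_tail_tendsto:
  assumes y: "y > 0"
  shows "mixed_tail y \<longlonglongrightarrow> arctan_int y"
proof (rule tendsto_sandwich)
  have "continuous_on {0..y} arctan_int"
    unfolding arctan_int_def
    by (intro indefinite_integral_continuous_1 integrable_continuous_real arctan_quot_continuous)
  moreover have "(\<lambda>M. y / Suc M) \<longlonglongrightarrow> 0"
    using LIMSEQ_Suc[OF lim_const_over_n[of y]] by simp
  moreover have "y / Suc M \<in> {0..y}" for M using y by (auto simp: field_simps)
  ultimately have "(\<lambda>M. arctan_int (y / Suc M)) \<longlonglongrightarrow> arctan_int 0"
    using y by (intro continuous_on_tendsto_compose[of "{0..y}" arctan_int]) auto
  then have "(\<lambda>M. arctan_int y - arctan_int (y / Suc M)) \<longlonglongrightarrow> arctan_int y - arctan_int 0"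
    by (intro tendsto_intros)
  then show "(\<lambda>M. arctan_int y - arctan_int (y / Suc M)) \<longlonglongrightarrow> arctan_int y" by simp
  show "\<forall>\<^sub>F M in sequentially. arctan_int y - arctan_int (y / Suc M) \<le> mixed_tail y M"
    by (rule eventually_sequentiallyI[of 1], rule mixed_tail_bounds(2)) (use y in auto)
  show "\<forall>\<^sub>F M in sequentially. mixed_tail y M \<le> arctan_int y"
    by (rule eventually_sequentiallyI[of 1], rule mixed_tail_bounds(1)) (use y in auto)
qed auto

text \<open>Minus the logarithm of the product of all 1 - q^n at q = exp(-2 pi y), with the
  geometric sum over n carried out; see \<open>ln_euler_product\<close>. In this shape the partial
  fractions apply term by term.\<close>

definition lambert :: "real \<Rightarrow> real" where
  "lambert y = (\<Sum>m. 1 / (real (Suc m) * (exp (2 * pi * (real (Suc m) * y)) - 1)))"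

lemma lambert_summable:
  assumes y: "y > 0"
  shows "summable (\<lambda>m. 1 / (real (Suc m) * (exp (2 * pi * (real (Suc m) * y)) - 1)))"
proof (rule summable_comparison_test')
  let ?q = "exp (- (2 * pi * y))"
  have q: "0 < ?q" "?q < 1" using y by auto
  show "summable (\<lambda>m. ?q ^ Suc m * (1 / (1 - ?q)))"
    using q by (intro summable_mult2 summable_ignore_initial_segment[where k = 1, simplified] summable_geometric) auto
  show "norm (1 / (real (Suc m) * (exp (2 * pi * (real (Suc m) * y)) - 1))) \<le> ?q ^ Suc m * (1 / (1 - ?q))" for m
  proof -
    have e: "exp (2 * pi * (real (Suc m) * y)) = 1 / ?q ^ Suc m"
      by (simp add: exp_of_nat_mult[symmetric] exp_minus field_simps del: of_nat_Suc power_Suc)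
    have m: "?q ^ Suc m \<le> ?q" using q power_decreasing[of 1 "Suc m" ?q] by simp
    then have "1 - ?q ^ Suc m > 0" using q by linarith
    have "norm (1 / (real (Suc m) * (exp (2 * pi * (real (Suc m) * y)) - 1))) =
       ?q ^ Suc m / (real (Suc m) * (1 - ?q ^ Suc m))"
      unfolding e using \<open>1 - ?q ^ Suc m > 0\<close> by (simp add: field_simps del: of_nat_Suc power_Suc)
    also have "\<dots> \<le> ?q ^ Suc m / (1 * (1 - ?q))"
      using q m \<open>1 - ?q ^ Suc m > 0\<close> by (intro divide_left_mono mult_mono mult_pos_pos) (auto simp del: power_Suc)
    finally show ?thesis by simp
  qed
qed

text \<open>Everything is cut at the same \<open>M\<close>, because the pieces do not all converge:
  the harmonic sum has no limit. It does not involve \<open>y\<close>, so it disappears from the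
  difference for \<open>y\<close> and \<open>1 / y\<close>.\<close>

lemma lambert_partial:
  assumes y: "y > 0" and M: "M > 0"
  shows "(\<Sum>m=1..M. 1 / (real m * (exp (2 * pi * (real m * y)) - 1))) =
    (1 / pi) * ((\<Sum>m=1..M. \<Sum>k=1..M. y / ((real m * y)\<^sup>2 + (real k)\<^sup>2)) + mixed_tail y M)
     - (\<Sum>m=1..M. 1 / (2 * real m)) + 1 / (2 * pi * y) * (\<Sum>m=1..M. 1 / (real m)\<^sup>2)"
proof -
  have "1 / (real m * (exp (2 * pi * (real m * y)) - 1)) =
     (1 / pi) * ((\<Sum>k=1..M. y / ((real m * y)\<^sup>2 + (real k)\<^sup>2)) +
       (\<Sum>k. y / ((real m * y)\<^sup>2 + (real (Suc (k + M)))\<^sup>2)))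
     - 1 / (2 * real m) + 1 / (2 * pi * y) * (1 / (real m)\<^sup>2)" if m: "m \<in> {1..M}" for m
  proof -
    let ?x = "real m * y"
    have x: "?x > 0" using m y by auto
    have "exp (2 * pi * ?x) > 1" using x by simp
    let ?S = "pi / ?x * (1 / (exp (2 * pi * ?x) - 1) + 1 / 2 - 1 / (2 * pi * ?x))"
    have s: "(\<lambda>k. y * (1 / (?x\<^sup>2 + (real (Suc k))\<^sup>2))) sums (y * ?S)"
      by (intro sums_mult inverse_exp_minus_one_partial_fractions x)
    from sums_split_initial_segment[OF this, of M]
    have "(\<Sum>k. y / (?x\<^sup>2 + (real (Suc (k + M)))\<^sup>2)) = y * ?S - (\<Sum>k<M. y / (?x\<^sup>2 + (real (Suc k))\<^sup>2))"
      by (intro sums_unique[symmetric]) (simp del: of_nat_Suc)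
    moreover have "(\<Sum>k=1..M. y / (?x\<^sup>2 + (real k)\<^sup>2)) = (\<Sum>k<M. y / (?x\<^sup>2 + (real (Suc k))\<^sup>2))"
      by (simp only: One_nat_def sum.atLeast1_atMost_eq)
    ultimately have "(\<Sum>k=1..M. y / (?x\<^sup>2 + (real k)\<^sup>2)) + (\<Sum>k. y / (?x\<^sup>2 + (real (Suc (k + M)))\<^sup>2)) = y * ?S"
      by simp
    moreover define e where "e = 1 / (exp (2 * pi * ?x) - 1)"
    moreover have "1 / (real m * (exp (2 * pi * ?x) - 1)) = e / m"
      by (simp add: e_def)
    moreover have "e / m = (1 / pi) * (y * (pi / ?x * (e + 1 / 2 - 1 / (2 * pi * ?x))))
        - 1 / (2 * real m) + 1 / (2 * pi * y) * (1 / (real m)\<^sup>2)"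
      using x y m by (simp add: field_simps power2_eq_square)
    ultimately show ?thesis by (simp only:)
  qed
  then have "(\<Sum>m=1..M. 1 / (real m * (exp (2 * pi * (real m * y)) - 1))) =
    (\<Sum>m=1..M. (1 / pi) * ((\<Sum>k=1..M. y / ((real m * y)\<^sup>2 + (real k)\<^sup>2)) +
       (\<Sum>k. y / ((real m * y)\<^sup>2 + (real (Suc (k + M)))\<^sup>2)))
     - 1 / (2 * real m) + 1 / (2 * pi * y) * (1 / (real m)\<^sup>2))"
    by (rule sum.cong[OF refl])
  then show ?thesis
    unfolding mixed_tail_def by (simp only: sum.distrib sum_subtractf sum_distrib_left[symmetric])
qed

text \<open>The logarithm of eta(i/y) = sqrt(y) eta(iy) for the Dedekind eta function. In the
  difference of the truncated sums the square block and the harmonic sum cancel, the mixed tails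
  give ln y / 2 through the inverse tangent integral, and zeta(2) = pi^2 / 6 gives the factor pi /
  12.\<close>

theorem lambert_inversion:
  assumes y: "y > 0"
  shows "lambert y - lambert (1 / y) = ln y / 2 + pi / 12 * (1 / y - y)"
proof -
  let ?L = "\<lambda>y M. \<Sum>m=1..M. 1 / (real m * (exp (2 * pi * (real m * y)) - 1))"
  have lim: "?L y \<longlonglongrightarrow> lambert y" if "y > 0" for y
    using summable_LIMSEQ[OF lambert_summable[OF that]]
    unfolding lambert_def by (simp only: One_nat_def sum.atLeast1_atMost_eq)
  have "?L y M - ?L (1 / y) M = (1 / pi) * (mixed_tail y M - mixed_tail (1 / y) M)
      + (1 / (2 * pi * y) - y / (2 * pi)) * (\<Sum>m=1..M. 1 / (real m)\<^sup>2)" if M: "M > 0" for M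
  proof -
    have "(\<Sum>m=1..M. \<Sum>k=1..M. (1 / y) / ((real m * (1 / y))\<^sup>2 + (real k)\<^sup>2)) =
       (\<Sum>m=1..M. \<Sum>k=1..M. y / ((real k * y)\<^sup>2 + (real m)\<^sup>2))"
    proof (intro sum.cong refl)
      fix m k assume "m \<in> {1..M}" "k \<in> {1..M}"
      then have "(real m * (1 / y))\<^sup>2 + (real k)\<^sup>2 = ((real k * y)\<^sup>2 + (real m)\<^sup>2) / y\<^sup>2"
        using y by (simp add: field_simps)
      then show "(1 / y) / ((real m * (1 / y))\<^sup>2 + (real k)\<^sup>2) = y / ((real k * y)\<^sup>2 + (real m)\<^sup>2)"
        using y by (simp add: power2_eq_square)
    qed
    also have "\<dots> = (\<Sum>m=1..M. \<Sum>k=1..M. y / ((real m * y)\<^sup>2 + (real k)\<^sup>2))"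
      by (rule sum.swap)
    finally have eq: "(\<Sum>m=1..M. \<Sum>k=1..M. (1 / y) / ((real m * (1 / y))\<^sup>2 + (real k)\<^sup>2)) =
       (\<Sum>m=1..M. \<Sum>k=1..M. y / ((real m * y)\<^sup>2 + (real k)\<^sup>2))" .
    \<comment> \<open>\<open>D\<close> is the square block, \<open>H\<close> the harmonic sum and
      \<open>Z\<close> the sum of inverse squares; \<open>u\<close> and \<open>v\<close> are the
      mixed tails.\<close>
    have *: "(1 / pi) * (D + u) - H + 1 / (2 * pi * y) * Z - ((1 / pi) * (D + v) - H + 1 / (2 * pi * (1 / y)) * Z)
      = (1 / pi) * (u - v) + (1 / (2 * pi * y) - y / (2 * pi)) * Z" for D H Z u v
      using y by (simp add: field_simps)
    have y': "1 / y > 0" using y by simp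
    show ?thesis
      unfolding lambert_partial[OF y M] lambert_partial[OF y' M] eq by (rule *)
  qed
  then have "\<forall>\<^sub>F M in sequentially. (1 / pi) * (mixed_tail y M - mixed_tail (1 / y) M)
      + (1 / (2 * pi * y) - y / (2 * pi)) * (\<Sum>m=1..M. 1 / (real m)\<^sup>2) = ?L y M - ?L (1 / y) M"
    by (intro eventually_sequentiallyI[of 1]) auto
  moreover have "(\<lambda>M. (1 / pi) * (mixed_tail y M - mixed_tail (1 / y) M)
      + (1 / (2 * pi * y) - y / (2 * pi)) * (\<Sum>m=1..M. 1 / (real m)\<^sup>2)) \<longlonglongrightarrow>
      (1 / pi) * (arctan_int y - arctan_int (1 / y)) + (1 / (2 * pi * y) - y / (2 * pi)) * (pi\<^sup>2 / 6)"
  proof (intro tendsto_intros mixed_tail_tendsto)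
    show "(\<lambda>M. \<Sum>m=1..M. 1 / (real m)\<^sup>2) \<longlonglongrightarrow> pi\<^sup>2 / 6"
      using inverse_squares_sums unfolding sums_def by (simp add: sum.atLeast1_atMost_eq add.commute)
  qed (use y in auto)
  ultimately have "(\<lambda>M. ?L y M - ?L (1 / y) M) \<longlonglongrightarrow>
      (1 / pi) * (arctan_int y - arctan_int (1 / y)) + (1 / (2 * pi * y) - y / (2 * pi)) * (pi\<^sup>2 / 6)"
    by (rule Lim_transform_eventually[rotated])
  moreover have "(\<lambda>M. ?L y M - ?L (1 / y) M) \<longlonglongrightarrow> lambert y - lambert (1 / y)"
    using y by (intro tendsto_diff lim) auto
  ultimately have "lambert y - lambert (1 / y) =
      (1 / pi) * (arctan_int y - arctan_int (1 / y)) + (1 / (2 * pi * y) - y / (2 * pi)) * (pi\<^sup>2 / 6)"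
    using LIMSEQ_unique by blast
  also have "\<dots> = ln y / 2 + pi / 12 * (1 / y - y)"
    unfolding arctan_int_inverse[OF y] using y by (simp add: field_simps power2_eq_square)
  finally show ?thesis .
qed

text \<open>The terms q^(m n) / m are nonnegative, so the double sum can be taken in either order:
  over \<open>n\<close> first it is geometric and gives \<open>lambert\<close>, over
  \<open>m\<close> first it is the logarithmic series.\<close>

lemma ln_euler_product:
  assumes y: "y > 0"
  shows "(\<lambda>n. ln (1 - exp (- (2 * pi * y)) ^ Suc n)) sums (- lambert y)"
proof -
  let ?q = "exp (- (2 * pi * y))"
  have q: "0 < ?q" "?q < 1" using y by auto
  have qn: "0 < ?q ^ Suc n" "?q ^ Suc n < 1" for n
    using q by (auto simp del: power_Suc intro: power_Suc_less_one)
  let ?f = "\<lambda>m n. ?q ^ (Suc m * Suc n) / real (Suc m)"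
  have row: "((\<lambda>n. ?f m n) has_sum 1 / (real (Suc m) * (exp (2 * pi * (real (Suc m) * y)) - 1))) UNIV" for m
  proof -
    have e: "exp (2 * pi * (real (Suc m) * y)) = 1 / ?q ^ Suc m"
      by (simp add: exp_of_nat_mult[symmetric] exp_minus field_simps del: of_nat_Suc power_Suc)
    have "(\<lambda>n. (?q ^ Suc m) ^ n) sums (1 / (1 - ?q ^ Suc m))"
      using qn[of m] by (intro geometric_sums) (simp del: power_Suc)
    then have "(\<lambda>n. (?q ^ Suc m) ^ n * (?q ^ Suc m / real (Suc m))) sums (1 / (1 - ?q ^ Suc m) * (?q ^ Suc m / real (Suc m)))"
      by (rule sums_mult2)
    also have "(\<lambda>n. (?q ^ Suc m) ^ n * (?q ^ Suc m / real (Suc m))) = (\<lambda>n. ?f m n)"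
      by (simp add: power_mult[symmetric] power_add[symmetric] algebra_simps del: power_Suc of_nat_Suc)
    also have "1 / (1 - ?q ^ Suc m) * (?q ^ Suc m / real (Suc m)) = 1 / (real (Suc m) * (exp (2 * pi * (real (Suc m) * y)) - 1))"
      unfolding e using qn[of m] by (simp add: field_simps del: of_nat_Suc power_Suc)
    finally show ?thesis by (rule sums_nonneg_imp_has_sum) (use q in auto)
  qed
  have col: "((\<lambda>m. ?f m n) has_sum - ln (1 - ?q ^ Suc n)) UNIV" for n
  proof -
    have "(\<lambda>m. - ((- (- (?q ^ Suc n))) ^ m) / of_nat m) sums ln (1 + - (?q ^ Suc n))"
      using qn[of n] by (intro ln_series') (simp del: power_Suc)
    \<comment> \<open>The logarithmic series starts at index 0, where division by zero makes the
      term vanish; the shift drops it.\<close>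
    then have "(\<lambda>m. - ((?q ^ Suc n) ^ Suc m / of_nat (Suc m))) sums ln (1 - ?q ^ Suc n)"
      by (subst sums_Suc_iff) (simp del: power_Suc of_nat_Suc)
    from sums_minus[OF this] have "(\<lambda>m. (?q ^ Suc n) ^ Suc m / of_nat (Suc m)) sums - ln (1 - ?q ^ Suc n)"
      by (simp del: power_Suc of_nat_Suc)
    also have "(\<lambda>m. (?q ^ Suc n) ^ Suc m / of_nat (Suc m)) = (\<lambda>m. ?f m n)"
      by (simp only: power_mult[symmetric] mult.commute)
    finally show ?thesis by (rule sums_nonneg_imp_has_sum) (use q in auto)
  qed
  have L: "((\<lambda>m. 1 / (real (Suc m) * (exp (2 * pi * (real (Suc m) * y)) - 1))) has_sum lambert y) UNIV"
    unfolding lambert_def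
    by (rule sums_nonneg_imp_has_sum[OF summable_sums[OF lambert_summable[OF y]]]) (use y in auto)
  have "((\<lambda>(m, n). ?f m n) has_sum lambert y) (UNIV \<times> UNIV)"
  proof (rule has_sum_SigmaI[OF _ L])
    show "(\<lambda>(m, n). ?f m n) summable_on UNIV \<times> UNIV"
    proof (rule summable_on_SigmaI[OF _ has_sum_imp_summable[OF L]])
      show "((\<lambda>n. case (m, n) of (m, n) \<Rightarrow> ?f m n) has_sum
          1 / (real (Suc m) * (exp (2 * pi * (real (Suc m) * y)) - 1))) UNIV" for m
        unfolding prod.case by (rule row)
    qed (use q in auto)
  qed (unfold prod.case, rule row)
  then have "((\<lambda>(n, m). ?f m n) has_sum lambert y) (UNIV \<times> UNIV)"
    unfolding has_sum_swap[of "\<lambda>(m, n). ?f m n"] prod.case .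
  then have "((\<lambda>n. - ln (1 - ?q ^ Suc n)) has_sum lambert y) UNIV"
    by (rule has_sum_SigmaD) (unfold prod.case, rule col)
  from sums_minus[OF has_sum_imp_sums[OF this]] show ?thesis by simp
qed

section \<open>The generating function of the Ramanujan function\<close>

text \<open>Kept polymorphic so that the same polynomial is available as a formal power series over
  the integers, over the complex numbers, and as a function.\<close>

definition euler_partial :: "nat \<Rightarrow> 'a :: comm_ring_1 \<Rightarrow> 'a" where
  "euler_partial N q = (\<Prod>i<N. (1 - q ^ Suc i) ^ 24)"

lemma one_minus_power_expand:
  fixes u :: "'a :: comm_ring_1"
  shows "\<exists>h. (1 - u) ^ k = 1 + u * h"
proof (induction k)
  case (Suc k)
  then obtain h where h: "(1 - u) ^ k = 1 + u * h" by blast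
  have "(1 - u) ^ Suc k = 1 + u * (h - 1 - u * h)"
    by (simp add: h algebra_simps)
  then show ?case by blast
qed (auto intro: exI[of _ 0])

text \<open>The next factor has the form 1 + X^(N+1) h, so it changes only coefficients of index
  above N.\<close>

lemma euler_partial_nth_stable:
  assumes "n < N"
  shows "fps_nth (euler_partial N (fps_X :: int fps)) n = fps_nth (euler_partial (Suc n) fps_X) n"
  using assms
proof (induction N)
  case (Suc N)
  show ?case
  proof (cases "n = N")
    case False
    then have n: "n < N" using Suc by simp
    obtain h :: "int fps" where h: "(1 - fps_X ^ Suc N) ^ 24 = 1 + fps_X ^ Suc N * h"
      using one_minus_power_expand by blast
    have "euler_partial (Suc N) (fps_X :: int fps) = euler_partial N fps_X + fps_X ^ Suc N * (euler_partial N fps_X * h)"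
      unfolding euler_partial_def by (simp add: h[unfolded power_Suc] algebra_simps)
    then have "fps_nth (euler_partial (Suc N) (fps_X :: int fps)) n = fps_nth (euler_partial N fps_X) n"
      using n by (simp add: fps_X_power_mult_nth del: power_Suc)
    then show ?thesis using Suc.IH[OF n] by simp
  qed simp
qed simp

text \<open>X-adic convergence means that each coefficient becomes constant, so the infinite product
  in \<open>ramanujan_tau\<close> can be replaced by a finite one. The index shift comes from the
  factor \<open>fps_X\<close>.\<close>

lemma ramanujan_tau_Suc:
  assumes "m < N"
  shows "ramanujan_tau (Suc m) = fps_nth (euler_partial N (fps_X :: int fps)) m"
proof -
  define G where "G = Abs_fps (\<lambda>n. fps_nth (euler_partial (Suc n) (fps_X :: int fps)) n)"
  let ?g = "\<lambda>n. (1 - fps_X ^ Suc n :: int fps) ^ 24"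
  have "(\<lambda>n. \<Prod>i\<le>n. ?g (i + 0)) \<longlonglongrightarrow> G"
  proof (rule tendsto_fpsI)
    fix m
    have "fps_nth (\<Prod>i\<le>n. ?g (i + 0)) m = fps_nth G m" if "m \<le> n" for n
      using euler_partial_nth_stable[of m "Suc n"] that
      by (simp add: G_def euler_partial_def lessThan_Suc_atMost)
    then show "\<forall>\<^sub>F n in sequentially. fps_nth (\<Prod>i\<le>n. ?g (i + 0)) m = fps_nth G m"
      by (auto simp: eventually_sequentially)
  qed
  \<comment> \<open>\<open>has_prod\<close> demands a nonzero limit; the constant coefficient
    settles this.\<close>
  moreover have "fps_nth G 0 = 1"
    by (simp add: G_def euler_partial_def fps_power_zeroth)
  then have "G \<noteq> 0" by auto
  ultimately have "?g has_prod G"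
    unfolding has_prod_def raw_has_prod_def by blast
  then have "prodinf ?g = G" by (rule has_prod_unique[symmetric])
  then have "ramanujan_tau (Suc m) = fps_nth G m"
    by (simp add: ramanujan_tau_def)
  also have "\<dots> = fps_nth (euler_partial N (fps_X :: int fps)) m"
    using euler_partial_nth_stable[OF assms] by (simp add: G_def)
  finally show ?thesis .
qed

lemma euler_partial_fps_of_int:
  "fps_nth (euler_partial N (fps_X :: complex fps)) m = of_int (fps_nth (euler_partial N (fps_X :: int fps)) m)"
proof -
  define R :: "int fps \<Rightarrow> complex fps \<Rightarrow> bool" where
    "R a b \<longleftrightarrow> (\<forall>n. fps_nth b n = of_int (fps_nth a n))" for a b
  have R1: "R 1 1" by (simp add: R_def)
  have Rmult: "R (a * c) (b * d)" if "R a b" "R c d" for a b c d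
    using that by (simp add: R_def fps_mult_nth)
  have Rdiff: "R (1 - fps_X ^ k) (1 - fps_X ^ k)" for k
    by (simp add: R_def fps_X_power_nth)
  have Rpow: "R (a ^ k) (b ^ k)" if "R a b" for a b k
    by (induction k) (auto intro: Rmult that R1)
  have "R (euler_partial N fps_X) (euler_partial N fps_X)"
    unfolding euler_partial_def by (induction N) (auto intro!: Rmult Rpow Rdiff R1 simp del: power_Suc)
  then show ?thesis by (simp add: R_def)
qed

lemma euler_partial_has_fps_expansion:
  "(euler_partial N :: complex \<Rightarrow> complex) has_fps_expansion euler_partial N fps_X"
  unfolding euler_partial_def by (intro fps_expansion_intros)

lemma euler_partial_holomorphic: "(euler_partial N :: complex \<Rightarrow> complex) holomorphic_on S"
  unfolding euler_partial_def by (intro holomorphic_intros)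

section \<open>Locally uniform convergence of the Euler product in the unit disc\<close>

lemma uniform_limit_power:
  fixes f :: "nat \<Rightarrow> 'a \<Rightarrow> complex"
  assumes "uniform_limit S f l sequentially" "bounded (l ` S)"
  shows "uniform_limit S (\<lambda>n x. f n x ^ k) (\<lambda>x. l x ^ k) sequentially"
proof (induction k)
  case (Suc k)
  have "bounded ((\<lambda>x. l x ^ k) ` S)"
  proof -
    obtain B where "\<And>x. x \<in> S \<Longrightarrow> norm (l x) \<le> B" using assms(2) by (auto simp: bounded_iff)
    then show ?thesis by (auto simp: bounded_iff norm_power intro!: exI[of _ "B ^ k"] power_mono)
  qed
  then show ?case using uniform_lim_mult[OF assms(1) Suc assms(2)] by simp
qed (simp add: uniform_limit_const)

definition euler24 :: "complex \<Rightarrow> complex" where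
  "euler24 q = lim (\<lambda>N. euler_partial N q)"

lemma euler24_uniform_limit:
  assumes r: "0 \<le> r" "r < 1"
  shows "uniform_limit (cball 0 r) euler_partial euler24 sequentially"
proof -
  let ?p = "\<lambda>N x. \<Prod>n<N. 1 + - ((x :: complex) ^ Suc n)"
  have "uniformly_convergent_on (cball 0 r) ?p"
  proof (rule uniformly_convergent_on_prod)
    show "uniformly_convergent_on (cball (0::complex) r) (\<lambda>N x. \<Sum>n<N. norm (- (x ^ Suc n)))"
    proof (rule Weierstrass_m_test'_ev)
      show "\<forall>\<^sub>F n in sequentially. \<forall>x\<in>cball (0::complex) r. norm (norm (- (x ^ Suc n))) \<le> r ^ Suc n"
        by (intro always_eventually) (auto simp: norm_power norm_mult simp del: power_Suc intro!: power_mono)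
      show "summable (\<lambda>n. r ^ Suc n)"
        using r by (intro summable_ignore_initial_segment[where k = 1, simplified] summable_geometric) auto
    qed
  qed (auto intro!: continuous_intros)
  then obtain l where l: "uniform_limit (cball 0 r) ?p l sequentially"
    by (auto simp: uniformly_convergent_on_def)
  have "continuous_on (cball 0 r) l"
    by (rule uniform_limit_theorem[OF _ l]) (auto intro!: always_eventually continuous_intros)
  then have "bounded (l ` cball 0 r)"
    by (intro compact_imp_bounded compact_continuous_image) auto
  from uniform_limit_power[OF l this, of 24]
  have u: "uniform_limit (cball 0 r) euler_partial (\<lambda>x. l x ^ 24) sequentially"
    by (simp add: euler_partial_def[abs_def] prod_power_distrib)
  have "l x ^ 24 = euler24 x" if "x \<in> cball 0 r" for x
    unfolding euler24_def using tendsto_uniform_limitI[OF u that] by (simp add: limI)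
  with u show ?thesis using uniform_limit_cong'[of "cball 0 r" euler_partial euler_partial "\<lambda>x. l x ^ 24" euler24] by blast
qed

lemma euler24_tendsto:
  assumes "norm q < 1"
  shows "(\<lambda>N. euler_partial N q) \<longlonglongrightarrow> euler24 q"
  using tendsto_uniform_limitI[OF euler24_uniform_limit[OF norm_ge_zero assms], of q] by simp

lemma euler24_holomorphic: "euler24 holomorphic_on ball 0 1"
proof (rule holomorphic_uniform_sequence[where f = euler_partial])
  fix x :: complex assume x: "x \<in> ball 0 1"
  let ?d = "(1 - norm x) / 2"
  have sub: "cball x ?d \<subseteq> cball 0 ((1 + norm x) / 2)"
    by (rule cball_subset_cball_iff[THEN iffD2]) (simp add: field_simps)
  have "uniform_limit (cball x ?d) euler_partial euler24 sequentially"
    using x by (intro uniform_limit_on_subset[OF euler24_uniform_limit sub]) auto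
  moreover have "cball x ?d \<subseteq> ball 0 1"
    using sub x by (auto simp: subset_iff)
  ultimately show "\<exists>d>0. cball x d \<subseteq> ball 0 1 \<and> uniform_limit (cball x d) euler_partial euler24 sequentially"
    using x by (intro exI[of _ ?d]) auto
qed (auto intro: euler_partial_holomorphic)

text \<open>The passage from formal to analytic: locally uniform convergence carries over to all
  derivatives at 0, and the Taylor coefficients of the partial products are eventually constant and
  equal to the formal ones.\<close>

theorem ramanujan_tau_sums:
  assumes q: "norm q < 1"
  shows "(\<lambda>n. of_int (ramanujan_tau (Suc n)) * q ^ n) sums euler24 q"
proof -
  have "(deriv ^^ n) euler24 0 / fact n = complex_of_int (ramanujan_tau (Suc n))" for n
  proof -
    have "uniform_limit (ball 0 (1 / 2)) euler_partial euler24 sequentially"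
      by (rule uniform_limit_on_subset[OF euler24_uniform_limit[of "1 / 2"]]) auto
    then have "(\<lambda>N. (deriv ^^ n) (euler_partial N) 0) \<longlonglongrightarrow> (deriv ^^ n) euler24 0"
      by (rule higher_deriv_complex_uniform_limit) (auto intro!: always_eventually euler_partial_holomorphic)
    moreover have "\<forall>\<^sub>F N in sequentially. (deriv ^^ n) (euler_partial N) 0 = fact n * complex_of_int (ramanujan_tau (Suc n))"
    proof (rule eventually_sequentiallyI[of "Suc n"])
      fix N assume "Suc n \<le> N"
      have "(deriv ^^ n) (euler_partial N) 0 / fact n = fps_nth (euler_partial N (fps_X :: complex fps)) n"
        using fps_nth_fps_expansion[OF euler_partial_has_fps_expansion[of N], of n] by simp
      then show "(deriv ^^ n) (euler_partial N) 0 = fact n * complex_of_int (ramanujan_tau (Suc n))"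
        using \<open>Suc n \<le> N\<close> ramanujan_tau_Suc[of n N] by (simp add: euler_partial_fps_of_int field_simps)
    qed
    ultimately have "(\<lambda>N. fact n * complex_of_int (ramanujan_tau (Suc n))) \<longlonglongrightarrow> (deriv ^^ n) euler24 0"
      by (rule Lim_transform_eventually)
    then have "fact n * complex_of_int (ramanujan_tau (Suc n)) = (deriv ^^ n) euler24 0"
      by (simp add: LIMSEQ_const_iff)
    from this [symmetric] show ?thesis by simp
  qed
  then show ?thesis
    using holomorphic_power_series[OF euler24_holomorphic, of q] q by simp
qed

lemma euler24_real:
  assumes y: "y > 0"
  shows "euler24 (of_real (exp (- (2 * pi * y)))) = of_real (exp (- 24 * lambert y))"
proof -
  let ?q = "exp (- (2 * pi * y))"
  have q: "0 < ?q" "?q < 1" using y by auto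
  have "(\<lambda>N. exp (24 * (\<Sum>n<N. ln (1 - ?q ^ Suc n)))) \<longlonglongrightarrow> exp (24 * (- lambert y))"
    using ln_euler_product[OF y] unfolding sums_def by (intro tendsto_intros)
  moreover have "exp (24 * (\<Sum>n<N. ln (1 - ?q ^ Suc n))) = euler_partial N ?q" for N
  proof -
    have "exp (24 * (\<Sum>n<N. ln (1 - ?q ^ Suc n))) = (\<Prod>n<N. exp (24 * ln (1 - ?q ^ Suc n)))"
      by (simp add: sum_distrib_left exp_sum)
    also have "\<dots> = euler_partial N ?q"
      unfolding euler_partial_def
    proof (rule prod.cong[OF refl])
      fix n
      have "?q ^ Suc n < 1" using q by (intro power_Suc_less_one) auto
      then show "exp (24 * ln (1 - ?q ^ Suc n)) = (1 - ?q ^ Suc n) ^ 24"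
        using exp_of_nat_mult[of 24 "ln (1 - ?q ^ Suc n)"] by simp
    qed
    finally show ?thesis .
  qed
  ultimately have "(\<lambda>N. euler_partial N ?q) \<longlonglongrightarrow> exp (24 * (- lambert y))" by simp
  then have "(\<lambda>N. complex_of_real (euler_partial N ?q)) \<longlonglongrightarrow> of_real (exp (24 * (- lambert y)))"
    by (rule tendsto_of_real)
  moreover have "complex_of_real (euler_partial N ?q) = euler_partial N (of_real ?q)" for N
    by (simp add: euler_partial_def)
  ultimately have "(\<lambda>N. euler_partial N (of_real ?q)) \<longlonglongrightarrow> complex_of_real (exp (24 * (- lambert y)))"
    by simp
  moreover have "(\<lambda>N. euler_partial N (of_real ?q)) \<longlonglongrightarrow> euler24 (of_real ?q)"
    using q by (intro euler24_tendsto) simp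
  ultimately show ?thesis using LIMSEQ_unique by force
qed

section \<open>Modularity and the mean square of the coefficients\<close>

text \<open>The modular discriminant up to the factor (2 pi)^12, in the half plane variable.\<close>

definition disc :: "complex \<Rightarrow> complex" where
  "disc \<tau> = exp (2 * of_real pi * \<i> * \<tau>) * euler24 (exp (2 * of_real pi * \<i> * \<tau>))"

lemma nome_norm: "norm (exp (2 * of_real pi * \<i> * \<tau>)) = exp (- (2 * pi * Im \<tau>))"
  by (simp add: norm_exp_eq_Re)

lemma disc_holomorphic: "disc holomorphic_on {\<tau>. Im \<tau> > 0}"
proof -
  have "(\<lambda>\<tau>. euler24 (exp (2 * of_real pi * \<i> * \<tau>))) holomorphic_on {\<tau>. Im \<tau> > 0}"
    by (rule holomorphic_on_compose_gen[OF _ euler24_holomorphic, unfolded o_def])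
      (auto intro!: holomorphic_intros simp: nome_norm)
  then show ?thesis unfolding disc_def by (intro holomorphic_intros)
qed

lemma disc_periodic: "disc (\<tau> + of_int k) = disc \<tau>"
proof -
  have "exp (2 * of_real pi * \<i> * (\<tau> + of_int k)) = exp (2 * of_real pi * \<i> * \<tau>)"
    unfolding exp_eq by (intro exI[of _ k]) (simp add: algebra_simps)
  then show ?thesis by (simp add: disc_def)
qed

lemma disc_imaginary:
  assumes "y > 0"
  shows "disc (\<i> * of_real y) = of_real (exp (- (2 * pi * y) - 24 * lambert y))"
proof -
  have "exp (2 * of_real pi * \<i> * (\<i> * of_real y)) = complex_of_real (exp (- (2 * pi * y)))"
  proof -
    have "2 * of_real pi * \<i> * (\<i> * of_real y) = complex_of_real (- (2 * pi * y))"
      by (simp add: complex_eq_iff)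
    then show ?thesis by (simp only: exp_of_real)
  qed
  then show ?thesis
    unfolding disc_def using euler24_real[OF assms] by (simp add: exp_diff exp_minus field_simps)
qed

text \<open>24 times the inversion of \<open>lambert\<close>: ln y / 2 becomes the exponent of
  \<open>y ^ 12\<close>, and pi / 12 becomes 2 pi, which is exactly compensated by the leading
  factor q of \<Delta>.\<close>

lemma disc_inversion_imaginary:
  assumes y: "y > 0"
  shows "disc (\<i> * of_real (1 / y)) = of_real (y ^ 12) * disc (\<i> * of_real y)"
proof -
  have "exp (- (2 * pi * (1 / y)) - 24 * lambert (1 / y)) =
     exp (12 * ln y + (- (2 * pi * y) - 24 * lambert y))"
  proof -
    have "24 * (l / 2 + pi / 12 * (1 / y - y)) = 12 * l + 2 * pi * (1 / y) - 2 * pi * y" for l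
      by (simp add: right_diff_distrib)
    from this[of "ln y", folded lambert_inversion[OF y]]
    have "- (2 * pi * (1 / y)) - 24 * lambert (1 / y) = 12 * ln y + (- (2 * pi * y) - 24 * lambert y)"
      by simp
    then show ?thesis by simp
  qed
  also have "\<dots> = y ^ 12 * exp (- (2 * pi * y) - 24 * lambert y)"
    using y exp_of_nat_mult[of 12 "ln y"] by (simp add: exp_add)
  finally show ?thesis
    using y disc_imaginary[of "1 / y"] disc_imaginary[OF y] by simp
qed

text \<open>Both sides are holomorphic in the upper half plane and agree on the positive imaginary
  axis, which accumulates at \<open>\<i>\<close>; the identity theorem does the rest.\<close>

theorem disc_inversion:
  assumes "Im \<tau> > 0"
  shows "disc (- 1 / \<tau>) = \<tau> ^ 12 * disc \<tau>"
proof -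
  let ?S = "{\<tau>. Im \<tau> > 0}"
  let ?f = "\<lambda>\<tau>. disc (- 1 / \<tau>) - \<tau> ^ 12 * disc \<tau>"
  let ?U = "(\<lambda>y. \<i> * complex_of_real y) ` {0<..}"
  have im: "Im (- 1 / \<tau>) > 0" if "Im \<tau> > 0" for \<tau>
    using that by (auto simp: Im_divide intro!: divide_pos_pos add_nonneg_pos)
  have "(\<lambda>\<tau>. disc (- 1 / \<tau>)) holomorphic_on ?S"
    by (rule holomorphic_on_compose_gen[OF _ disc_holomorphic, unfolded o_def])
      (use im in \<open>auto intro!: holomorphic_intros\<close>)
  then have f: "?f holomorphic_on ?S"
    by (intro holomorphic_intros disc_holomorphic)
  have lim: "\<i> islimpt ?U"
    unfolding islimpt_approachable
  proof (intro allI impI)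
    fix e :: real assume "e > 0"
    then show "\<exists>x'\<in>?U. x' \<noteq> \<i> \<and> dist x' \<i> < e"
      by (intro bexI[of _ "\<i> * of_real (1 + e / 2)"])
        (auto simp: dist_norm complex_eq_iff algebra_simps norm_mult norm_divide)
  qed
  have zero: "?f z = 0" if z: "z \<in> ?U" for z
  proof -
    obtain y where y: "y > 0" "z = \<i> * of_real y" using z by auto
    have "- 1 / z = \<i> * of_real (1 / y)" using y by (simp add: complex_eq_iff Re_divide Im_divide power2_eq_square)
    \<comment> \<open>The weight is divisible by 4, so the powers of \<open>\<i>\<close> leave no
      sign.\<close>
    moreover have "z ^ 12 = of_real (y ^ 12)"
      using y(2) power_mult[of \<i> 2 6] by (simp add: power_mult_distrib)
    ultimately show ?thesis using disc_inversion_imaginary[OF y(1)] y(2) by simp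
  qed
  have "?f \<tau> = 0"
  proof (rule analytic_continuation[OF f _ _ _ _ lim zero])
    show "open ?S" by (rule open_halfspace_Im_gt)
    show "connected ?S" by (intro convex_connected convex_halfspace_Im_gt)
  qed (use assms in auto)
  then show ?thesis by simp
qed

text \<open>Here |q| \<le> exp(-pi), so \<open>euler24\<close> is bounded by compactness, and the
  decay exp(-2 pi y) of the leading q beats y^6 because 6 < 2 pi.\<close>

lemma disc_bound_aux:
  "\<exists>C. \<forall>\<tau>. Im \<tau> \<ge> 1 / 2 \<longrightarrow> norm (disc \<tau>) * Im \<tau> ^ 6 \<le> C"
proof -
  let ?K = "cball (0 :: complex) (exp (- pi))"
  have "exp (- pi) < 1" by simp
  then have "?K \<subseteq> ball 0 1" by (intro cball_subset_ball_iff[THEN iffD2]) simp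
  then have "continuous_on ?K euler24"
    by (intro holomorphic_on_imp_continuous_on holomorphic_on_subset[OF euler24_holomorphic])
  then have "bounded (euler24 ` ?K)"
    by (intro compact_imp_bounded compact_continuous_image) auto
  then obtain B where B: "\<And>q. q \<in> ?K \<Longrightarrow> norm (euler24 q) \<le> B"
    unfolding bounded_iff by blast
  have "norm (disc \<tau>) * Im \<tau> ^ 6 \<le> B" if "Im \<tau> \<ge> 1 / 2" for \<tau>
  proof -
    let ?q = "exp (2 * of_real pi * \<i> * \<tau>)" and ?y = "Im \<tau>"
    have "?q \<in> ?K" using that by (simp add: nome_norm field_simps)
    then have b: "norm (euler24 ?q) \<le> B" by (rule B)
    have "?y \<le> exp ?y" using exp_ge_add_one_self[of ?y] by linarith
    then have "?y ^ 6 \<le> exp ?y ^ 6" using that by (intro power_mono) auto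
    also have "\<dots> = exp (6 * ?y)" using exp_of_nat_mult[of 6 ?y] by simp
    also have "\<dots> \<le> exp (2 * pi * ?y)" using that pi_gt3 by (simp add: mult_right_mono)
    finally have "exp (- (2 * pi * ?y)) * ?y ^ 6 \<le> 1" by (simp add: exp_minus field_simps)
    then have "norm (euler24 ?q) * (exp (- (2 * pi * ?y)) * ?y ^ 6) \<le> B * 1"
      using b by (intro mult_mono) (auto intro: order_trans[OF norm_ge_zero])
    then show ?thesis unfolding disc_def by (simp add: norm_mult nome_norm mult_ac)
  qed
  then show ?thesis by blast
qed

text \<open>
  If \<open>Im \<tau> < 1/2\<close> and \<open>\<bar>Re \<tau>\<bar> \<le> 1/2\<close> then \<open>\<bar>\<tau>\<bar>\<^sup>2 \<le> 1/2\<close>, so the inversion at least doubles the imaginary part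
  and finitely many steps reach \<open>Im \<tau> \<ge> 1/2\<close>.
\<close>
lemma disc_bound:
  "\<exists>C. \<forall>\<tau>. Im \<tau> > 0 \<longrightarrow> norm (disc \<tau>) * Im \<tau> ^ 6 \<le> C"
proof -
  obtain C where C: "\<And>\<tau>. Im \<tau> \<ge> 1 / 2 \<Longrightarrow> norm (disc \<tau>) * Im \<tau> ^ 6 \<le> C"
    using disc_bound_aux by blast
  have *: "norm (disc \<tau>) * Im \<tau> ^ 6 \<le> C" if "2 ^ n * Im \<tau> \<ge> 1 / 2" "Im \<tau> > 0" for n \<tau>
    using that
  proof (induction n arbitrary: \<tau>)
    case 0
    then show ?case using C by simp
  next
    case (Suc n)
    show ?case
    proof (cases "Im \<tau> \<ge> 1 / 2")
      case False
      define \<sigma> where "\<sigma> = \<tau> + of_int (- round (Re \<tau>))"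
      have s: "disc \<sigma> = disc \<tau>" "Im \<sigma> = Im \<tau>" unfolding \<sigma>_def by (rule disc_periodic) simp
      have "\<bar>Re \<sigma>\<bar> \<le> 1 / 2" using of_int_round_abs_le[of "Re \<tau>"] by (simp add: \<sigma>_def abs_minus_commute)
      then have "(Re \<sigma>)\<^sup>2 \<le> (1 / 2)\<^sup>2" by (simp flip: abs_le_square_iff)
      moreover have "(Im \<sigma>)\<^sup>2 \<le> (1 / 2)\<^sup>2" using False Suc s by (intro power_mono) auto
      ultimately have n: "(norm \<sigma>)\<^sup>2 \<le> 1 / 2" unfolding cmod_power2 by (simp add: power2_eq_square)
      have pos: "(norm \<sigma>)\<^sup>2 > 0" using Suc s by (cases "\<sigma> = 0") auto
      have im: "Im (- 1 / \<sigma>) = Im \<tau> / (norm \<sigma>)\<^sup>2"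
        using s by (simp add: Im_divide cmod_power2)
      have "2 * Im \<tau> \<le> Im \<tau> / (norm \<sigma>)\<^sup>2"
        using n pos Suc by (simp add: field_simps mult_left_mono)
      then have "2 ^ n * (2 * Im \<tau>) \<le> 2 ^ n * Im (- 1 / \<sigma>)" unfolding im by (intro mult_left_mono) auto
      then have "1 / 2 \<le> 2 ^ n * Im (- 1 / \<sigma>)" using Suc.prems(1) by simp
      moreover have "Im (- 1 / \<sigma>) > 0" unfolding im using pos Suc.prems(2) by simp
      ultimately have "norm (disc (- 1 / \<sigma>)) * Im (- 1 / \<sigma>) ^ 6 \<le> C" by (rule Suc.IH)
      \<comment> \<open>The weight 12 is twice the exponent 6, so the function to be bounded is
        invariant under the inversion.\<close>
      moreover have "norm (disc (- 1 / \<sigma>)) * Im (- 1 / \<sigma>) ^ 6 = norm (disc \<tau>) * Im \<tau> ^ 6"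
      proof -
        have "norm (disc (- 1 / \<sigma>)) = (norm \<sigma>) ^ 12 * norm (disc \<tau>)"
          using disc_inversion[of \<sigma>] Suc s by (simp add: norm_mult norm_power)
        moreover have "Im (- 1 / \<sigma>) ^ 6 = Im \<tau> ^ 6 / norm \<sigma> ^ 12"
          unfolding im by (simp add: power_divide flip: power_mult)
        ultimately show ?thesis using pos by simp
      qed
      ultimately show ?thesis by simp
    qed (use C in auto)
  qed
  have "norm (disc \<tau>) * Im \<tau> ^ 6 \<le> C" if "Im \<tau> > 0" for \<tau>
  proof -
    obtain n where "1 / 2 / Im \<tau> < 2 ^ n" using real_arch_pow[of 2 "1 / 2 / Im \<tau>"] by auto
    then show ?thesis using that by (intro *[of n]) (auto simp: field_simps)
  qed
  then show ?thesis by blast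
qed

section \<open>Parseval on roots of unity and the mean square of the coefficients\<close>

lemma sum_roots_of_unity:
  fixes n m K :: nat
  assumes "n < K" "m < K"
  defines "\<omega> \<equiv> \<lambda>j :: nat. exp (2 * of_real pi * \<i> * of_nat j / of_nat K)"
  shows "(\<Sum>j<K. \<omega> j ^ n * cnj (\<omega> j ^ m)) = (if n = m then of_nat K else 0)"
proof -
  let ?z = "\<omega> n * cnj (\<omega> m)"
  have K: "K > 0" using assms by simp
  have cnj: "cnj (\<omega> j) = inverse (\<omega> j)" for j
    unfolding \<omega>_def exp_cnj exp_minus [symmetric] by simp
  have nz: "\<omega> j \<noteq> 0" for j by (simp add: \<omega>_def)
  \<comment> \<open>This symmetry turns the sum over \<open>j\<close> into a geometric progression
    with ratio \<open>?z\<close>, a nontrivial \<open>K\<close>-th root of unity when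
    \<open>n \<noteq> m\<close>.\<close>
  have \<omega>: "\<omega> j ^ k = \<omega> k ^ j" for j k
    unfolding \<omega>_def exp_of_nat_mult [symmetric] by (simp add: mult_ac)
  have "\<omega> j ^ n * cnj (\<omega> j ^ m) = ?z ^ j" for j
    unfolding \<omega>[of j] by (simp add: power_mult_distrib)
  then have s: "(\<Sum>j<K. \<omega> j ^ n * cnj (\<omega> j ^ m)) = (\<Sum>j<K. ?z ^ j)" by simp
  show ?thesis
  proof (cases "n = m")
    case True
    then have "?z = 1" using nz by (simp add: cnj)
    then show ?thesis using s True by simp
  next
    case False
    have "\<omega> n \<noteq> \<omega> m"
    proof
      assume "\<omega> n = \<omega> m"
      then have "n mod K = m mod K"
        using complex_root_unity_eq[of K n m] K by (simp add: \<omega>_def mult_ac)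
      then show False using False assms by simp
    qed
    then have "?z \<noteq> 1" using nz by (simp add: cnj divide_inverse[symmetric])
    moreover have "?z ^ K = 1"
    proof -
      have "\<omega> K = 1" using K by (simp add: \<omega>_def)
      then have "\<omega> n ^ K = 1" for n
        unfolding \<omega>[of n K] by simp
      then show ?thesis by (simp add: power_mult_distrib flip: complex_cnj_power)
    qed
    ultimately show ?thesis using s False by (simp add: geometric_sum)
  qed
qed

text \<open>
  Discrete Parseval identity on the \<open>K\<close>-th roots of unity for the partial sum of length \<open>K\<close>; the tail
  disappears as \<open>K\<close> grows.
\<close>
lemma power_series_mean_square_bound:
  fixes a :: "nat \<Rightarrow> complex" and r :: real
  assumes r: "r \<ge> 0" and sm: "summable (\<lambda>n. norm (a n) * r ^ n)"
    and B: "\<And>w. norm w = r \<Longrightarrow> norm (\<Sum>n. a n * w ^ n) \<le> B"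
  shows "(\<Sum>n<N. (norm (a n))\<^sup>2 * r ^ (2 * n)) \<le> B\<^sup>2"
proof (rule LIMSEQ_le_const)
  define t where "t K = (\<Sum>n. norm (a (n + K)) * r ^ (n + K))" for K
  show "(\<lambda>K. (B + t K)\<^sup>2) \<longlonglongrightarrow> B\<^sup>2"
    using suminf_exist_split2[OF sm] unfolding t_def
    by (auto intro!: tendsto_eq_intros)
  show "\<exists>K0. \<forall>K\<ge>K0. (\<Sum>n<N. (norm (a n))\<^sup>2 * r ^ (2 * n)) \<le> (B + t K)\<^sup>2"
  proof (intro exI allI impI)
    fix K assume K: "K \<ge> Suc N"
    define \<omega> where "\<omega> j = exp (2 * of_real pi * \<i> * of_nat j / of_nat K)" for j
    have n\<omega>: "norm (\<omega> j) = 1" for j by (simp add: \<omega>_def norm_exp_eq_Re)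
    define f where "f j = (\<Sum>n<K. a n * (of_real r * \<omega> j) ^ n)" for j
    have fb: "norm (f j) \<le> B + t K" for j
    proof -
      let ?w = "of_real r * \<omega> j"
      have w: "norm ?w = r" using r n\<omega> by (simp add: norm_mult)
      have sn: "summable (\<lambda>n. norm (a n * ?w ^ n))"
        using sm w by (simp add: norm_mult norm_power)
      then have "(\<Sum>n. a n * ?w ^ n) = (\<Sum>n. a (n + K) * ?w ^ (n + K)) + f j"
        unfolding f_def by (rule suminf_split_initial_segment[OF summable_norm_cancel])
      then have "norm (f j) \<le> norm (\<Sum>n. a n * ?w ^ n) + norm (\<Sum>n. a (n + K) * ?w ^ (n + K))"
        using norm_triangle_ineq4[of "\<Sum>n. a n * ?w ^ n" "\<Sum>n. a (n + K) * ?w ^ (n + K)"] by simp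
      also have "norm (\<Sum>n. a (n + K) * ?w ^ (n + K)) \<le> (\<Sum>n. norm (a (n + K) * ?w ^ (n + K)))"
        by (rule summable_norm) (rule summable_ignore_initial_segment[OF sn])
      also have "\<dots> = t K" unfolding t_def by (simp add: norm_mult norm_power n\<omega> r)
      finally show ?thesis using B[OF w] by simp
    qed
    have "(\<Sum>j<K. f j * cnj (f j)) =
        (\<Sum>j<K. \<Sum>n<K. \<Sum>m<K. a n * cnj (a m) * of_real (r ^ n * r ^ m) * (\<omega> j ^ n * cnj (\<omega> j ^ m)))"
      unfolding f_def by (simp add: sum_product power_mult_distrib mult_ac)
    also have "\<dots> = (\<Sum>n<K. \<Sum>m<K. a n * cnj (a m) * of_real (r ^ n * r ^ m) * (\<Sum>j<K. \<omega> j ^ n * cnj (\<omega> j ^ m)))"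
      unfolding sum_distrib_left by (subst sum.swap, rule sum.cong[OF refl], rule sum.swap)
    also have "\<dots> = (\<Sum>n<K. \<Sum>m<K. if n = m then of_nat K * of_real ((norm (a n))\<^sup>2 * r ^ (2 * n)) else 0)"
    proof (intro sum.cong refl)
      fix n m assume "n \<in> {..<K}" "m \<in> {..<K}"
      then have "(\<Sum>j<K. \<omega> j ^ n * cnj (\<omega> j ^ m)) = (if n = m then of_nat K else 0)"
        unfolding \<omega>_def by (intro sum_roots_of_unity) auto
      moreover have "a n * cnj (a n) * of_real (r ^ n * r ^ n) = of_real ((norm (a n))\<^sup>2 * r ^ (2 * n))"
        by (simp add: complex_norm_square power_add mult_2 del: of_real_power)
      ultimately show "a n * cnj (a m) * of_real (r ^ n * r ^ m) * (\<Sum>j<K. \<omega> j ^ n * cnj (\<omega> j ^ m)) =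
         (if n = m then of_nat K * of_real ((norm (a n))\<^sup>2 * r ^ (2 * n)) else 0)"
        by (auto simp: mult_ac)
    qed
    also have "\<dots> = of_real (real K * (\<Sum>n<K. (norm (a n))\<^sup>2 * r ^ (2 * n)))"
      by (simp add: sum_distrib_left)
    finally have "complex_of_real (\<Sum>j<K. (norm (f j))\<^sup>2) = of_real (real K * (\<Sum>n<K. (norm (a n))\<^sup>2 * r ^ (2 * n)))"
      unfolding of_real_sum complex_norm_square .
    then have "real K * (\<Sum>n<K. (norm (a n))\<^sup>2 * r ^ (2 * n)) = (\<Sum>j<K. (norm (f j))\<^sup>2)"
      by (simp only: of_real_eq_iff)
    also have "\<dots> \<le> (\<Sum>j<K. (B + t K)\<^sup>2)"
      using fb by (intro sum_mono power_mono) auto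
    finally have "(\<Sum>n<K. (norm (a n))\<^sup>2 * r ^ (2 * n)) \<le> (B + t K)\<^sup>2"
      using K by simp
    moreover have "(\<Sum>n<N. (norm (a n))\<^sup>2 * r ^ (2 * n)) \<le> (\<Sum>n<K. (norm (a n))\<^sup>2 * r ^ (2 * n))"
      using K r by (intro sum_mono2) auto
    ultimately show "(\<Sum>n<N. (norm (a n))\<^sup>2 * r ^ (2 * n)) \<le> (B + t K)\<^sup>2" by linarith
  qed
qed

lemma ramanujan_tau_abs_summable:
  assumes "0 \<le> r" "r < 1"
  shows "summable (\<lambda>n. norm (complex_of_int (ramanujan_tau (Suc n))) * r ^ n)"
proof -
  have "norm (complex_of_real ((1 + r) / 2)) < 1"
    unfolding norm_of_real using assms by simp
  moreover have "norm (complex_of_real r) < norm (complex_of_real ((1 + r) / 2))"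
    unfolding norm_of_real using assms by simp
  ultimately show ?thesis
    using powser_insidea[OF sums_summable[OF ramanujan_tau_sums], of "of_real ((1 + r) / 2)" "of_real r"]
      assms by (simp add: norm_mult norm_power)
qed

text \<open>The circle |q| = exp(-2 pi / N) corresponds to Im \<tau> = 1 / N, where |\<Delta>| \<le>
  C N^6. On it the weights r^(2 n + 2) for n < N are at least exp(-4 pi), so the weighted mean
  square controls the unweighted one.\<close>

lemma ramanujan_tau_square_sum:
  "\<exists>C\<ge>0. \<forall>N>0. (\<Sum>n<N. (real_of_int (ramanujan_tau (Suc n)))\<^sup>2) \<le> C * real N ^ 12"
proof -
  obtain C where C: "\<And>\<tau>. Im \<tau> > 0 \<Longrightarrow> norm (disc \<tau>) * Im \<tau> ^ 6 \<le> C"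
    using disc_bound by blast
  have "(\<Sum>n<N. (real_of_int (ramanujan_tau (Suc n)))\<^sup>2) \<le> exp (4 * pi) * C\<^sup>2 * real N ^ 12"
    if N: "N > 0" for N
  proof -
    let ?a = "\<lambda>n. complex_of_int (ramanujan_tau (Suc n))"
    define r where "r = exp (- (2 * pi * (1 / real N)))"
    have r: "0 < r" "r < 1" using N by (auto simp: r_def)
    have "norm (\<Sum>n. ?a n * w ^ n) \<le> C * real N ^ 6 / r" if w: "norm w = r" for w
    proof -
      have "w \<noteq> 0" using w r by auto
      \<comment> \<open>Any logarithm would do, since \<open>disc\<close> depends on
        \<open>\<tau>\<close> only through the exponential.\<close>
      define \<tau> where "\<tau> = Ln w / (2 * of_real pi * \<i>)"
      have q: "exp (2 * of_real pi * \<i> * \<tau>) = w" using \<open>w \<noteq> 0\<close> by (simp add: \<tau>_def)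
      have "exp (- (2 * pi * Im \<tau>)) = r" using nome_norm[of \<tau>] w unfolding q by simp
      then have im: "Im \<tau> = 1 / N" unfolding r_def using N by (simp add: field_simps)
      have "(\<Sum>n. ?a n * w ^ n) = euler24 w"
        using ramanujan_tau_sums[of w] w r by (simp add: sums_iff)
      then have "norm (disc \<tau>) = r * norm (\<Sum>n. ?a n * w ^ n)"
        unfolding disc_def q by (simp add: norm_mult w)
      then have "r * norm (\<Sum>n. ?a n * w ^ n) * (1 / N) ^ 6 \<le> C"
        using C[of \<tau>] im N by simp
      then show ?thesis using r N by (simp add: field_simps)
    qed
    then have "(\<Sum>n<N. (norm (?a n))\<^sup>2 * r ^ (2 * n)) \<le> (C * real N ^ 6 / r)\<^sup>2"
      using r by (intro power_series_mean_square_bound ramanujan_tau_abs_summable) auto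
    then have "r\<^sup>2 * (\<Sum>n<N. (norm (?a n))\<^sup>2 * r ^ (2 * n)) \<le> C\<^sup>2 * real N ^ 12"
      using r by (simp add: power_divide power_mult_distrib field_simps flip: power_mult)
    moreover have "r\<^sup>2 * (\<Sum>n<N. (norm (?a n))\<^sup>2 * r ^ (2 * n)) \<ge>
        (\<Sum>n<N. (real_of_int (ramanujan_tau (Suc n)))\<^sup>2 * exp (- (4 * pi)))"
      unfolding sum_distrib_left
    proof (intro sum_mono)
      fix n assume n: "n \<in> {..<N}"
      have "exp (- (4 * pi)) = r ^ (2 * N)"
        using N unfolding r_def exp_of_nat_mult [symmetric] by simp
      also have "\<dots> \<le> r ^ (2 * n + 2)" using n r by (intro power_decreasing) auto
      finally have "(real_of_int (ramanujan_tau (Suc n)))\<^sup>2 * exp (- (4 * pi)) \<le> (real_of_int (ramanujan_tau (Suc n)))\<^sup>2 * r ^ (2 * n + 2)"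
        by (intro mult_left_mono) auto
      then show "(real_of_int (ramanujan_tau (Suc n)))\<^sup>2 * exp (- (4 * pi)) \<le> r\<^sup>2 * ((norm (?a n))\<^sup>2 * r ^ (2 * n))"
        by (simp add: power_add power2_eq_square mult_ac)
    qed
    ultimately have "(\<Sum>n<N. (real_of_int (ramanujan_tau (Suc n)))\<^sup>2) * exp (- (4 * pi)) \<le> C\<^sup>2 * real N ^ 12"
      by (simp add: sum_distrib_right)
    then show ?thesis by (simp add: exp_minus field_simps)
  qed
  then show ?thesis by (intro exI[of _ "exp (4 * pi) * C\<^sup>2"]) auto
qed

text \<open>Dyadic blocks in place of partial summation: the block starting at 2^J is at most C
  (2^(J+1))^12 times (2^J)^(-12-\<epsilon>), which is C 2^12 \<open>r ^ J\<close>.\<close>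

lemma summable_powr_of_square_sum_bound:
  fixes b :: "nat \<Rightarrow> real"
  assumes b: "\<And>N. N > 0 \<Longrightarrow> (\<Sum>n<N. b n) \<le> C * real N ^ 12" "\<And>n. b n \<ge> 0"
    and \<epsilon>: "\<epsilon> > 0"
  shows "summable (\<lambda>n. b n * real (Suc n) powr (- 12 - \<epsilon>))"
proof (rule summableI_nonneg_bounded)
  let ?g = "\<lambda>n. b n * real (Suc n) powr (- 12 - \<epsilon>)"
  define r where "r = 2 powr (- \<epsilon>)"
  have r: "0 < r" "r < 1" using \<epsilon> by (auto simp: r_def powr_less_one)
  have C: "C \<ge> 0" using b(1)[of 1] b(2)[of 0] by simp
  have bd: "(\<Sum>n<2 ^ J. ?g n) \<le> ?g 0 + (\<Sum>j<J. C * 2 ^ 12 * r ^ j)" for J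
  proof (induction J)
    case (Suc J)
    have split: "(\<Sum>n<2 ^ Suc J. ?g n) = (\<Sum>n<2 ^ J. ?g n) + (\<Sum>n\<in>{2 ^ J..<2 ^ Suc J}. ?g n)"
      unfolding lessThan_atLeast0 by (rule sum.atLeastLessThan_concat[symmetric]) auto
    have "(\<Sum>n\<in>{2 ^ J..<2 ^ Suc J}. ?g n) \<le> (\<Sum>n\<in>{2 ^ J..<2 ^ Suc J}. b n * (2 ^ J) powr (- 12 - \<epsilon>))"
    proof (rule sum_mono, rule mult_left_mono[OF _ b(2)])
      fix n :: nat assume "n \<in> {2 ^ J..<2 ^ Suc J}"
      then have "2 ^ J \<le> n" by simp
      then have "(2 :: real) ^ J \<le> real n" by (metis of_nat_le_iff of_nat_numeral of_nat_power)
      then have "(2 :: real) ^ J \<le> real (Suc n)" unfolding of_nat_Suc by linarith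
      then show "real (Suc n) powr (- 12 - \<epsilon>) \<le> (2 ^ J) powr (- 12 - \<epsilon>)"
        using \<epsilon> by (intro powr_mono2') (auto simp del: of_nat_Suc)
    qed
    also have "\<dots> \<le> (\<Sum>n<2 ^ Suc J. b n) * (2 ^ J) powr (- 12 - \<epsilon>)"
      unfolding sum_distrib_right[symmetric]
      by (rule mult_right_mono[OF sum_mono2]) (use b(2) in auto)
    also have "\<dots> \<le> (C * real (2 ^ Suc J) ^ 12) * (2 ^ J) powr (- 12 - \<epsilon>)"
      by (rule mult_right_mono[OF b(1)]) auto
    also have "\<dots> = C * 2 ^ 12 * r ^ J"
    proof -
      have "(2 ^ J) powr (- 12 - \<epsilon>) = ((2 :: real) ^ J) powr (- \<epsilon>) / (2 ^ J) ^ 12"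
      proof -
        have x: "(0 :: real) \<le> 2 ^ J" by simp
        have "((2 :: real) ^ J) powr (- 12 - \<epsilon>) = (2 ^ J) powr (- \<epsilon> - 12)"
          by (rule arg_cong[of _ _ "\<lambda>c. (2 ^ J) powr c"]) simp
        also have "\<dots> = (2 ^ J) powr (- \<epsilon>) / (2 ^ J) powr 12" by (rule powr_diff)
        also have "((2 :: real) ^ J) powr 12 = (2 ^ J) ^ 12" by (rule powr_numeral[OF x])
        finally show ?thesis .
      qed
      also have "((2 :: real) ^ J) powr (- \<epsilon>) = r ^ J"
      proof -
        have "((2 :: real) ^ J) powr (- \<epsilon>) = (2 powr real J) powr (- \<epsilon>)" by (simp add: powr_realpow)
        also have "\<dots> = (2 powr (- \<epsilon>)) powr real J" by (simp add: powr_powr mult.commute)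
        also have "\<dots> = r ^ J" unfolding r_def by (simp add: powr_realpow)
        finally show ?thesis .
      qed
      finally have "(2 ^ J) powr (- 12 - \<epsilon>) = r ^ J / (2 ^ J) ^ 12" .
      moreover have "real (2 ^ Suc J) ^ 12 = 2 ^ 12 * (2 ^ J) ^ 12"
        by (simp only: power_Suc of_nat_mult of_nat_power of_nat_numeral power_mult_distrib)
      moreover have "C * (2 ^ 12 * (2 ^ J) ^ 12) * (r ^ J / (2 ^ J) ^ 12) = C * 2 ^ 12 * r ^ J"
        by simp
      ultimately show ?thesis by (simp only:)
    qed
    finally show ?case using Suc.IH split unfolding sum.lessThan_Suc by linarith
  qed simp
  show "(\<Sum>n<N. ?g n) \<le> ?g 0 + (\<Sum>j. C * 2 ^ 12 * r ^ j)" for N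
  proof -
    have "(\<Sum>n<N. ?g n) \<le> (\<Sum>n<2 ^ N. ?g n)"
    proof (rule sum_mono2)
      show "{..<N} \<subseteq> {..<2 ^ N}" using less_exp[of N] by auto
    qed (use b(2) in auto)
    also have "\<dots> \<le> ?g 0 + (\<Sum>j<N. C * 2 ^ 12 * r ^ j)" by (rule bd)
    also have "(\<Sum>j<N. C * 2 ^ 12 * r ^ j) \<le> (\<Sum>j. C * 2 ^ 12 * r ^ j)"
      using r C by (intro sum_le_suminf summable_mult summable_geometric) auto
    finally show ?thesis by simp
  qed
  show "?g n \<ge> 0" for n using b(2) by simp
qed

text \<open>With \<epsilon> = \<sigma> - 13/2 the exponent splits as \<sigma> = (12 + \<epsilon>)/2
  + (1 + \<epsilon>)/2. The inequality 2xy \<le> x^2 + y^2 then leaves the mean square series and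
  the series of n^(-1-\<epsilon>); this is how 13/2 = 6 + 1/2 arises.\<close>

theorem ramanujan_tau_dirichlet_summable:
  assumes "\<sigma> > 13 / 2"
  shows "summable (\<lambda>n. \<bar>real_of_int (ramanujan_tau (Suc n))\<bar> * real (Suc n) powr (- \<sigma>))"
proof -
  let ?t = "\<lambda>n. real_of_int (ramanujan_tau (Suc n))"
  define \<epsilon> where "\<epsilon> = \<sigma> - 13 / 2"
  have \<epsilon>: "\<epsilon> > 0" using assms by (simp add: \<epsilon>_def)
  obtain C where C: "\<And>N. N > 0 \<Longrightarrow> (\<Sum>n<N. (?t n)\<^sup>2) \<le> C * real N ^ 12"
    using ramanujan_tau_square_sum by blast
  have s1: "summable (\<lambda>n. (?t n)\<^sup>2 * real (Suc n) powr (- 12 - \<epsilon>))"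
    by (rule summable_powr_of_square_sum_bound[OF C _ \<epsilon>]) auto
  have "summable (\<lambda>n. real n powr (- 1 - \<epsilon>))" using \<epsilon> by (simp add: summable_real_powr_iff)
  then have s2: "summable (\<lambda>n. real (Suc n) powr (- 1 - \<epsilon>))" by (subst summable_Suc_iff)
  show ?thesis
  proof (rule summable_comparison_test')
    show "summable (\<lambda>n. ((?t n)\<^sup>2 * real (Suc n) powr (- 12 - \<epsilon>) + real (Suc n) powr (- 1 - \<epsilon>)) / 2)"
      by (intro summable_divide summable_add s1 s2)
    fix n :: nat
    let ?x = "\<bar>?t n\<bar> * real (Suc n) powr ((- 12 - \<epsilon>) / 2)" and ?y = "real (Suc n) powr ((- 1 - \<epsilon>) / 2)"
    have sq: "(real (Suc n) powr (c / 2))\<^sup>2 = real (Suc n) powr c" for c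
      by (simp add: power2_eq_square flip: powr_add)
    have "- \<sigma> = (- 12 - \<epsilon>) / 2 + (- 1 - \<epsilon>) / 2" by (simp add: \<epsilon>_def field_simps)
    then have "\<bar>?t n\<bar> * real (Suc n) powr (- \<sigma>) = ?x * ?y" by (simp only: powr_add mult.assoc)
    also have "\<dots> \<le> (?x\<^sup>2 + ?y\<^sup>2) / 2" using sum_squares_bound[of ?x ?y] by simp
    also have "?x\<^sup>2 = (?t n)\<^sup>2 * real (Suc n) powr (- 12 - \<epsilon>)"
      by (simp only: power_mult_distrib sq power2_abs)
    also have "?y\<^sup>2 = real (Suc n) powr (- 1 - \<epsilon>)"
      by (rule sq)
    finally show "norm (\<bar>?t n\<bar> * real (Suc n) powr (- \<sigma>)) \<le>
        ((?t n)\<^sup>2 * real (Suc n) powr (- 12 - \<epsilon>) + real (Suc n) powr (- 1 - \<epsilon>)) / 2"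
      by simp
  qed
qed

section \<open>The kernel and its Laplace transform\<close>

text \<open>Euler's integral after the substitution u = c exp(t). On the whole line the inversion y
  -> 1/y becomes the reflection t -> -t.\<close>

lemma gamma_integral_exp:
  fixes s :: complex
  assumes s: "Re s > 0" and c: "c > 0"
  shows "has_bochner_integral lborel (\<lambda>t. exp (s * of_real t) * of_real (exp (- (c * exp t))))
     (of_real c powr (- s) * Gamma s)"
proof -
  let ?f = "\<lambda>u. complex_of_real u powr (s - 1) / of_real (exp u)"
  let ?h = "\<lambda>t. exp (s * of_real t) * complex_of_real (exp (- (c * exp t)))"
  have img: "(\<lambda>t. c * exp t) ` UNIV = {0<..}"
  proof (intro equalityI subsetI)
    fix u :: real assume "u \<in> {0<..}"
    then have "u = c * exp (ln (u / c))" using c by simp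
    then show "u \<in> (\<lambda>t. c * exp t) ` UNIV" by blast
  qed (use c in auto)
  have "((\<lambda>t. \<bar>c * exp t\<bar> *\<^sub>R ?f (c * exp t)) absolutely_integrable_on UNIV \<and>
      integral UNIV (\<lambda>t. \<bar>c * exp t\<bar> *\<^sub>R ?f (c * exp t)) = Gamma s) \<longleftrightarrow>
      (?f absolutely_integrable_on (\<lambda>t. c * exp t) ` UNIV \<and> integral ((\<lambda>t. c * exp t) ` UNIV) ?f = Gamma s)"
    using c by (intro has_absolute_integral_change_of_variables_real)
      (auto intro!: derivative_eq_intros simp: inj_on_def)
  moreover have "?f absolutely_integrable_on {0<..}"
    by (rule absolutely_integrable_Gamma_integral'[OF s])
  moreover have "integral {0<..} ?f = Gamma s"
    by (rule integral_unique[OF Gamma_integral_complex'[OF s]])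
  moreover have "\<bar>c * exp t\<bar> *\<^sub>R ?f (c * exp t) = of_real c powr s * ?h t" for t
  proof -
    have ln: "Ln (complex_of_real (c * exp t)) = of_real (ln c + t)"
      using c by (subst Ln_of_real) (auto simp: ln_mult)
    have "exp (ln c + t) = c * exp t" using c by (simp add: exp_add)
    then have a: "complex_of_real (c * exp t) = exp (of_real (ln c + t))"
      by (simp only: exp_of_real)
    have p: "complex_of_real (c * exp t) powr (s - 1) = exp ((s - 1) * of_real (ln c + t))"
      unfolding powr_def ln using c by simp
    have "\<bar>c * exp t\<bar> *\<^sub>R (X / of_real (exp u)) = of_real (c * exp t) * X * of_real (exp (- u))" for X :: complex and u
      using c by (simp add: scaleR_conv_of_real exp_minus divide_inverse abs_mult)
    then have "\<bar>c * exp t\<bar> *\<^sub>R ?f (c * exp t) =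
       exp (of_real (ln c + t)) * exp ((s - 1) * of_real (ln c + t)) * of_real (exp (- (c * exp t)))"
      unfolding p a[symmetric] .
    also have "exp (of_real (ln c + t)) * exp ((s - 1) * of_real (ln c + t)) = of_real c powr s * exp (s * of_real t)"
      using c by (simp add: powr_def Ln_of_real algebra_simps flip: exp_add)
    finally show ?thesis by (simp add: mult.assoc)
  qed
  ultimately have *: "(\<lambda>t. of_real c powr s * ?h t) absolutely_integrable_on UNIV"
    "integral UNIV (\<lambda>t. of_real c powr s * ?h t) = Gamma s"
    unfolding img by simp_all
  have meas: "(\<lambda>t. of_real c powr s * ?h t) \<in> borel_measurable lborel"
    by (auto intro!: borel_measurable_continuous_onI continuous_intros)
  \<comment> \<open>The substitution was made for the Lebesgue measure; since the integrand is Borel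
    measurable, its integral is the same for \<open>lborel\<close>.\<close>
  have 1: "integrable lebesgue (\<lambda>t. of_real c powr s * ?h t)"
    using *(1) by (simp add: set_integrable_def)
  then have "integrable lborel (\<lambda>t. of_real c powr s * ?h t)"
    using meas by (simp add: integrable_completion)
  moreover have "(LINT t|lborel. of_real c powr s * ?h t) = Gamma s"
  proof -
    have "(LINT t|lborel. of_real c powr s * ?h t) = (LINT t|lebesgue. of_real c powr s * ?h t)"
      using meas by (simp add: integral_completion)
    also have "\<dots> = Gamma s"
      using set_lebesgue_integral_eq_integral(2)[OF *(1)]
      unfolding set_lebesgue_integral_def indicator_UNIV scaleR_one *(2) .
    finally show ?thesis .
  qed
  ultimately have "has_bochner_integral lborel (\<lambda>t. of_real c powr s * ?h t) (Gamma s)"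
    by (simp add: has_bochner_integral_iff)
  then have "has_bochner_integral lborel (\<lambda>t. of_real c powr (- s) * (of_real c powr s * ?h t)) (of_real c powr (- s) * Gamma s)"
    by (rule has_bochner_integral_mult_right)
  moreover have "of_real c powr (- s) * (of_real c powr s * ?h t) = ?h t" for t
    using c by (simp add: powr_minus)
  ultimately show ?thesis by simp
qed

lemma gamma_integral_exp_real:
  fixes s c :: real
  assumes "s > 0" "c > 0"
  shows "has_bochner_integral lborel (\<lambda>t. exp (s * t - c * exp t)) (c powr (- s) * Gamma s)"
proof -
  have "has_bochner_integral lborel (\<lambda>t. Re (exp (of_real s * of_real t) * of_real (exp (- (c * exp t)))))
     (Re (of_real c powr (- of_real s) * Gamma (of_real s)))"
    using assms by (intro has_bochner_integral_bounded_linear[OF bounded_linear_Re] gamma_integral_exp) auto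
  moreover have "Re (exp (of_real s * of_real t) * of_real (exp (- (c * exp t)))) = exp (s * t - c * exp t)" for t
  proof -
    have "exp (of_real s * of_real t) * of_real (exp (- (c * exp t))) = complex_of_real (exp (s * t - c * exp t))"
      by (simp add: exp_diff exp_minus exp_of_real[symmetric] field_simps)
    then show ?thesis by simp
  qed
  moreover have "Re (of_real c powr (- of_real s) * Gamma (of_real s)) = c powr (- s) * Gamma s"
  proof -
    have "complex_of_real c powr (- of_real s) * Gamma (of_real s) = of_real (c powr (- s) * Gamma s)"
      using assms powr_of_real[of c "- s"] by (simp add: Gamma_complex_of_real)
    then show ?thesis by simp
  qed
  ultimately show ?thesis by simp
qed

text \<open>Written as one exponential, so that positivity needs no argument;
  \<open>disc_xi_kernel\<close> identifies it with \<Delta> on the imaginary axis times exp(6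
  t).\<close>

definition xi_kernel :: "real \<Rightarrow> real" where
  "xi_kernel t = exp (6 * t - 2 * pi * exp t - 24 * lambert (exp t))"

lemma xi_kernel_pos [simp]: "xi_kernel t > 0" and xi_kernel_nonneg [simp]: "xi_kernel t \<ge> 0"
  and xi_kernel_nonzero [simp]: "xi_kernel t \<noteq> 0"
  by (simp_all add: xi_kernel_def)

lemma disc_xi_kernel: "disc (\<i> * of_real (exp t)) * exp (6 * of_real t) = of_real (xi_kernel t)"
proof -
  have "exp (6 * complex_of_real t) = of_real (exp (6 * t))" by (simp flip: exp_of_real)
  then show ?thesis
    by (simp add: disc_imaginary xi_kernel_def exp_diff exp_minus field_simps exp_add del: of_real_exp)
qed

text \<open>The exponent 6 is half the weight: the 12 t produced by the inversion of \<Delta> is the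
  difference of 6 t and -6 t.\<close>

lemma xi_kernel_even: "xi_kernel (- t) = xi_kernel t"
proof -
  have "24 * (l / 2 + pi / 12 * (1 / y - y)) = 12 * l + 2 * pi * (1 / y) - 2 * pi * y" for l y :: real
    by (simp add: right_diff_distrib)
  from this[of t "exp t"] lambert_inversion[of "exp t"]
  have "24 * (lambert (exp t) - lambert (exp (- t))) = 12 * t + 2 * pi * exp (- t) - 2 * pi * exp t"
    by (simp add: exp_minus inverse_eq_divide)
  then show ?thesis by (simp add: xi_kernel_def)
qed

lemma lambert_nonneg: "y > 0 \<Longrightarrow> lambert y \<ge> 0"
  unfolding lambert_def by (rule suminf_nonneg[OF lambert_summable]) auto

lemma xi_kernel_bound: "xi_kernel t \<le> exp (6 * t - exp t)"
proof -
  have "1 * exp t \<le> 2 * pi * exp t" using pi_gt3 by (intro mult_right_mono) auto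
  then have "6 * t - 2 * pi * exp t - 24 * lambert (exp t) \<le> 6 * t - exp t"
    using lambert_nonneg[OF exp_gt_zero, of t] by linarith
  then show ?thesis unfolding xi_kernel_def by (simp only: exp_le_cancel_iff)
qed

lemma xi_kernel_measurable [measurable]: "xi_kernel \<in> borel_measurable borel"
proof (rule borel_measurable_continuous_onI)
  have "continuous_on UNIV (\<lambda>t. disc (\<i> * of_real (exp t)))"
    by (rule continuous_on_compose2[OF holomorphic_on_imp_continuous_on[OF disc_holomorphic]])
      (auto intro!: continuous_intros)
  then have "continuous_on UNIV (\<lambda>t. Re (disc (\<i> * of_real (exp t)) * exp (6 * of_real t)))"
    by (intro continuous_intros)
  then show "continuous_on UNIV xi_kernel" unfolding disc_xi_kernel by simp
qed

text \<open>The majorant exp((6 + r) t - exp(t)) is not integrable at minus infinity when r \<le>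
  -6, so only r \<ge> 0 is treated here. Evenness of the kernel settles the other half in
  \<open>xi_kernel_exp_abs_integrable\<close>.\<close>

lemma xi_kernel_exp_integrable_nonneg:
  assumes "r \<ge> 0"
  shows "integrable lborel (\<lambda>t. xi_kernel t * exp (r * t))"
    "(LINT t|lborel. xi_kernel t * exp (r * t)) \<le> (LINT t|lborel. exp ((6 + r) * t - exp t))"
proof -
  have i: "integrable lborel (\<lambda>t. exp ((6 + r) * t - 1 * exp t))"
    using gamma_integral_exp_real[of "6 + r" 1] assms by (intro integrable.intros) auto
  have b: "xi_kernel t * exp (r * t) \<le> exp ((6 + r) * t - exp t)" for t
  proof -
    have "xi_kernel t * exp (r * t) \<le> exp (6 * t - exp t) * exp (r * t)"
      by (intro mult_right_mono xi_kernel_bound) auto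
    also have "\<dots> = exp ((6 + r) * t - exp t)" by (simp add: algebra_simps flip: exp_add)
    finally show ?thesis .
  qed
  show 1: "integrable lborel (\<lambda>t. xi_kernel t * exp (r * t))"
    by (rule Bochner_Integration.integrable_bound[OF i]) (use b in \<open>auto simp: abs_mult\<close>)
  show "(LINT t|lborel. xi_kernel t * exp (r * t)) \<le> (LINT t|lborel. exp ((6 + r) * t - exp t))"
    by (rule integral_mono[OF 1]) (use i b in auto)
qed

lemma lborel_integrable_reflect:
  fixes f :: "real \<Rightarrow> 'a :: {banach, second_countable_topology}"
  shows "integrable lborel (\<lambda>t. f (- t)) \<longleftrightarrow> integrable lborel f"
  using lborel_integrable_real_affine_iff[of "- 1" f 0] by simp

lemma lborel_integral_reflect:
  fixes f :: "real \<Rightarrow> 'a :: {banach, second_countable_topology}"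
  shows "(LINT t|lborel. f (- t)) = (LINT t|lborel. f t)"
  using lborel_integral_real_affine[of "- 1" f 0] by simp

lemma xi_kernel_exp_abs_integrable: "integrable lborel (\<lambda>t. xi_kernel t * exp (r * \<bar>t\<bar>))"
proof -
  have 1: "integrable lborel (\<lambda>t. xi_kernel t * exp (\<bar>r\<bar> * t))"
    by (rule xi_kernel_exp_integrable_nonneg) simp
  then have "integrable lborel (\<lambda>t. xi_kernel (- t) * exp (\<bar>r\<bar> * (- t)))"
    by (subst lborel_integrable_reflect)
  with 1 have "integrable lborel (\<lambda>t. xi_kernel t * exp (\<bar>r\<bar> * t) + xi_kernel t * exp (- (\<bar>r\<bar> * t)))"
    by (simp add: xi_kernel_even)
  then show ?thesis
  proof (rule Bochner_Integration.integrable_bound)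
    have "exp (r * \<bar>t\<bar>) \<le> exp (\<bar>r\<bar> * t) + exp (- (\<bar>r\<bar> * t))" for t
    proof -
      have "r * \<bar>t\<bar> \<le> \<bar>r\<bar> * \<bar>t\<bar>" by (intro mult_right_mono) auto
      then have "exp (r * \<bar>t\<bar>) \<le> exp (\<bar>r\<bar> * \<bar>t\<bar>)" by simp
      also have "\<dots> \<le> exp (\<bar>r\<bar> * t) + exp (- (\<bar>r\<bar> * t))" by (cases "t \<ge> 0") auto
      finally show ?thesis .
    qed
    from mult_left_mono[OF this xi_kernel_nonneg]
    show "AE t in lborel. norm (xi_kernel t * exp (r * \<bar>t\<bar>)) \<le>
       norm (xi_kernel t * exp (\<bar>r\<bar> * t) + xi_kernel t * exp (- (\<bar>r\<bar> * t)))"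
      by (simp add: abs_mult distrib_left)
  qed auto
qed

section \<open>Moments of the kernel and the entire function F\<close>

definition moment :: "nat \<Rightarrow> real" where
  "moment n = (LINT t|lborel. xi_kernel t * t ^ n)"

lemma abs_power_le_exp: "\<bar>x\<bar> ^ n / fact n \<le> exp \<bar>x\<bar>" for x :: real
proof -
  have "(\<Sum>k<Suc n. inverse (fact k) *\<^sub>R \<bar>x\<bar> ^ k) \<le> (\<Sum>k. inverse (fact k) *\<^sub>R \<bar>x\<bar> ^ k)"
    by (intro sum_le_suminf summable_exp_generic) auto
  moreover have "inverse (fact n) *\<^sub>R \<bar>x\<bar> ^ n \<le> (\<Sum>k<Suc n. inverse (fact k) *\<^sub>R \<bar>x\<bar> ^ k)"
    by (simp add: sum_nonneg)
  ultimately show ?thesis by (simp add: exp_def field_simps)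
qed

lemma moment_integrable: "integrable lborel (\<lambda>t. xi_kernel t * t ^ n)"
proof (rule Bochner_Integration.integrable_bound)
  show "integrable lborel (\<lambda>t. fact n * (xi_kernel t * exp (1 * \<bar>t\<bar>)))"
    by (intro integrable_mult_right xi_kernel_exp_abs_integrable)
  have "\<bar>t\<bar> ^ n \<le> fact n * exp \<bar>t\<bar>" for t :: real
    using abs_power_le_exp[of t n] by (simp add: field_simps)
  from mult_left_mono[OF this xi_kernel_nonneg]
  show "AE t in lborel. norm (xi_kernel t * t ^ n) \<le> norm (fact n * (xi_kernel t * exp (1 * \<bar>t\<bar>)))"
    by (simp add: abs_mult power_abs mult_ac)
qed auto

lemma moment_even_pos: "moment (2 * n) > 0"
proof -
  have "moment (2 * n) \<ge> 0" unfolding moment_def by (intro integral_nonneg_AE) auto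
  moreover have "moment (2 * n) \<noteq> 0"
  proof
    assume "moment (2 * n) = 0"
    then have "AE t in lborel. xi_kernel t * t ^ (2 * n) = 0"
      unfolding moment_def using integral_nonneg_eq_0_iff_AE[OF moment_integrable[of "2 * n"]] by auto
    then have "AE t in (lborel :: real measure). t = 0"
      by eventually_elim auto
    moreover have "AE t in lborel. (t :: real) \<noteq> 0" by (rule AE_lborel_singleton)
    ultimately have "AE t in (lborel :: real measure). False" by eventually_elim simp
    then show False by (simp add: eventually_False ae_filter_eq_bot_iff)
  qed
  ultimately show ?thesis by simp
qed

lemma moment_odd: "odd n \<Longrightarrow> moment n = 0"
  using lborel_integral_reflect[of "\<lambda>t. xi_kernel t * t ^ n"] by (simp add: moment_def xi_kernel_even)

text \<open>The exponential series may be integrated term by term, because the kernel times exp(|z|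
  |t|) is integrable for every z and majorizes all partial sums.\<close>

lemma xi_kernel_laplace_sums:
  fixes z :: complex
  shows "integrable lborel (\<lambda>t. of_real (xi_kernel t) * exp (z * of_real t))"
    "(\<lambda>n. of_real (moment n / fact n) * z ^ n) sums (LINT t|lborel. of_real (xi_kernel t) * exp (z * of_real t))"
proof -
  let ?f = "\<lambda>n t. complex_of_real (xi_kernel t * t ^ n) * (z ^ n / fact n)"
  have int: "integrable lborel (?f n)" for n
    by (intro integrable_mult_left integrable_of_real moment_integrable)
  have f: "?f n t = of_real (xi_kernel t) * ((z * of_real t) ^ n /\<^sub>R fact n)" for n t
    by (simp add: power_mult_distrib scaleR_conv_of_real field_simps)
  have s: "(\<lambda>n. ?f n t) sums (of_real (xi_kernel t) * exp (z * of_real t))" for t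
    unfolding f by (intro sums_mult exp_converges)
  have nf: "norm (?f n t) = xi_kernel t * ((norm z * \<bar>t\<bar>) ^ n /\<^sub>R fact n)" for n t
    by (simp add: norm_mult norm_divide norm_power power_mult_distrib abs_mult power_abs field_simps)
  have ns: "(\<lambda>n. norm (?f n t)) sums (xi_kernel t * exp (norm z * \<bar>t\<bar>))" for t
    unfolding nf by (intro sums_mult exp_converges)
  have sm: "summable (\<lambda>n. LINT t|lborel. norm (?f n t))"
  proof (rule summableI_nonneg_bounded)
    fix N
    have "(\<Sum>n<N. LINT t|lborel. norm (?f n t)) = (LINT t|lborel. (\<Sum>n<N. norm (?f n t)))"
      by (intro Bochner_Integration.integral_sum[symmetric] integrable_norm int)
    also have "\<dots> \<le> (LINT t|lborel. xi_kernel t * exp (norm z * \<bar>t\<bar>))"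
    proof (rule integral_mono)
      show "(\<Sum>n<N. norm (?f n t)) \<le> xi_kernel t * exp (norm z * \<bar>t\<bar>)" for t
        using sum_le_suminf[OF sums_summable[OF ns[of t]], of "{..<N}"] sums_unique[OF ns[of t]] by simp
    qed (intro Bochner_Integration.integrable_sum integrable_norm int xi_kernel_exp_abs_integrable)+
    finally show "(\<Sum>n<N. LINT t|lborel. norm (?f n t)) \<le> (LINT t|lborel. xi_kernel t * exp (norm z * \<bar>t\<bar>))" .
  qed auto
  have ae: "AE t in lborel. summable (\<lambda>n. norm (?f n t))"
    using ns by (intro AE_I2) (auto simp: summable_def)
  have eq: "(\<Sum>n. ?f n t) = of_real (xi_kernel t) * exp (z * of_real t)" for t
    using sums_unique[OF s] by simp
  show "integrable lborel (\<lambda>t. of_real (xi_kernel t) * exp (z * of_real t))"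
    using integrable_suminf[OF int ae sm] unfolding eq .
  have int_eq: "(LINT t|lborel. ?f n t) = of_real (moment n / fact n) * z ^ n" for n
  proof -
    have "(LINT t|lborel. ?f n t) = (LINT t|lborel. complex_of_real (xi_kernel t * t ^ n)) * (z ^ n / fact n)"
      by (rule integral_mult_left_zero)
    also have "(LINT t|lborel. complex_of_real (xi_kernel t * t ^ n)) = of_real (moment n)"
      unfolding moment_def by (rule integral_complex_of_real)
    finally show ?thesis by simp
  qed
  show "(\<lambda>n. of_real (moment n / fact n) * z ^ n) sums (LINT t|lborel. of_real (xi_kernel t) * exp (z * of_real t))"
    using sums_integral[OF int ae sm] unfolding eq int_eq .
qed

text \<open>The function F with X(z) = F(z^2): once the odd moments drop out, the Laplace transform
  is a power series in z^2.\<close>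

definition xi_even :: "complex \<Rightarrow> complex" where
  "xi_even w = (\<Sum>n. of_real (moment (2 * n) / fact (2 * n)) * w ^ n)"

lemma xi_even_sums_square:
  fixes z :: complex
  shows "(\<lambda>n. of_real (moment (2 * n) / fact (2 * n)) * (z\<^sup>2) ^ n) sums (LINT t|lborel. of_real (xi_kernel t) * exp (z * of_real t))"
proof -
  have "strict_mono (\<lambda>n :: nat. 2 * n)" by (auto simp: strict_mono_def)
  moreover have "of_real (moment n / fact n) * z ^ n = 0" if "n \<notin> range (\<lambda>n. 2 * n)" for n
  proof -
    have "odd n" using that by (auto elim!: evenE)
    then show ?thesis by (simp add: moment_odd)
  qed
  ultimately show ?thesis
    using xi_kernel_laplace_sums(2)[of z] sums_mono_reindex[of "\<lambda>n. 2 * n" "\<lambda>n. of_real (moment n / fact n) * z ^ n"]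
    by (simp add: power_mult)
qed

lemma xi_even_square:
  fixes z :: complex
  shows "xi_even (z\<^sup>2) = (LINT t|lborel. of_real (xi_kernel t) * exp (z * of_real t))"
  unfolding xi_even_def using sums_unique[OF xi_even_sums_square] by simp

text \<open>Every complex number is a square, so convergence of the Laplace series at
  \<open>csqrt w\<close> suffices.\<close>

lemma xi_even_sums: "(\<lambda>n. of_real (moment (2 * n) / fact (2 * n)) * w ^ n) sums xi_even w"
  using xi_even_sums_square[of "csqrt w"] xi_even_square[of "csqrt w"] by simp

lemma xi_even_holomorphic: "xi_even holomorphic_on UNIV"
proof -
  have "xi_even holomorphic_on ball 0 R" for R
    by (rule power_series_holomorphic[where a = "\<lambda>n. of_real (moment (2 * n) / fact (2 * n))"])
      (use xi_even_sums in simp)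
  then have "xi_even field_differentiable at w" for w
    by (rule holomorphic_on_imp_differentiable_at[of _ "ball 0 (norm w + 1)"]) auto
  then show ?thesis by (simp add: holomorphic_on_def)
qed

text \<open>Both facts come from positive Taylor coefficients: on a circle about 0 the modulus is
  largest on the positive axis, and on that axis the constant term is already a positive lower
  bound.\<close>

lemma xi_even_norm_le: "norm (xi_even w) \<le> norm (xi_even (of_real (norm w)))"
  and xi_even_nonneg_real: "x \<ge> 0 \<Longrightarrow> xi_even (of_real x) \<noteq> 0"
proof -
  let ?b = "\<lambda>n. moment (2 * n) / fact (2 * n)"
  have b: "?b n \<ge> 0" for n using moment_even_pos[of n] by simp
  have s: "summable (\<lambda>n. ?b n * x ^ n)" and eq: "xi_even (of_real x) = of_real (\<Sum>n. ?b n * x ^ n)" for x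
  proof -
    have "(\<lambda>n. complex_of_real (?b n * x ^ n)) sums xi_even (of_real x)"
      using xi_even_sums[of "of_real x"] by simp
    then have "(\<lambda>n. ?b n * x ^ n) sums Re (xi_even (of_real x))"
      by (simp only: sums_Re[of "\<lambda>n. complex_of_real (?b n * x ^ n)", simplified Re_complex_of_real])
    then show 1: "summable (\<lambda>n. ?b n * x ^ n)" by (rule sums_summable)
    show "xi_even (of_real x) = of_real (\<Sum>n. ?b n * x ^ n)"
      using \<open>(\<lambda>n. complex_of_real (?b n * x ^ n)) sums xi_even (of_real x)\<close>
        sums_of_real[OF summable_sums[OF 1]] sums_unique2 by blast
  qed
  have "norm (xi_even w) \<le> (\<Sum>n. ?b n * norm w ^ n)"
  proof -
    have nn: "norm (complex_of_real (?b n) * w ^ n) = ?b n * norm w ^ n" for n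
      using b[of n] by (simp only: norm_mult norm_of_real norm_power abs_of_nonneg)
    then have "summable (\<lambda>n. norm (complex_of_real (?b n) * w ^ n))" using s by (simp only:)
    from summable_norm[OF this] show ?thesis unfolding nn xi_even_def .
  qed
  also have "\<dots> \<le> norm (xi_even (of_real (norm w)))"
    unfolding eq norm_of_real by simp
  finally show "norm (xi_even w) \<le> norm (xi_even (of_real (norm w)))" .
  assume x: "x \<ge> 0"
  have "(\<Sum>n<1. ?b n * x ^ n) \<le> (\<Sum>n. ?b n * x ^ n)"
    by (intro sum_le_suminf s mult_nonneg_nonneg b zero_le_power x) auto
  then have "(\<Sum>n. ?b n * x ^ n) > 0" using moment_even_pos[of 0] by simp
  then show "xi_even (of_real x) \<noteq> 0" unfolding eq by simp
qed

text \<open>The exponent is raised to the integer \<open>n\<close> for t \<ge> 0 and lowered to 6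
  for t < 0, which gives Gamma(6) + Gamma(n). As Gamma(6) = 120, the sum is at most 121 n!.\<close>

lemma gamma_integral_bound:
  assumes "r \<ge> 0" "6 + r \<le> real n"
  shows "(LINT t|lborel. exp ((6 + r) * t - exp t)) \<le> 121 * fact n"
proof -
  have g: "has_bochner_integral lborel (\<lambda>t. exp (x * t - exp t)) (Gamma x)" if "x > 0" for x :: real
    using gamma_integral_exp_real[OF that, of 1] by simp
  have n: "real n > 0" using assms by simp
  have "(LINT t|lborel. exp ((6 + r) * t - exp t)) \<le>
      (LINT t|lborel. exp (6 * t - exp t) + exp (real n * t - exp t))"
  proof (rule integral_mono)
    show "integrable lborel (\<lambda>t. exp ((6 + r) * t - exp t))"
      by (rule integrable.intros[OF g]) (use assms in auto)
    show "integrable lborel (\<lambda>t. exp (6 * t - exp t) + exp (real n * t - exp t))"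
      by (intro Bochner_Integration.integrable_add integrable.intros[OF g] n) auto
    show "exp ((6 + r) * t - exp t) \<le> exp (6 * t - exp t) + exp (real n * t - exp t)" for t
    proof (cases "t \<ge> 0")
      case True
      then have "exp ((6 + r) * t - exp t) \<le> exp (real n * t - exp t)"
        using assms by (auto intro: mult_right_mono)
      then show ?thesis by (simp add: add_increasing)
    next
      case False
      then have "(6 + r) * t \<le> 6 * t" using assms by (simp add: mult_right_mono_neg)
      then have "exp ((6 + r) * t - exp t) \<le> exp (6 * t - exp t)" by simp
      then show ?thesis by (simp add: add_increasing2)
    qed
  qed
  also have "\<dots> = Gamma 6 + Gamma (real n)"
    using n by (intro has_bochner_integral_integral_eq has_bochner_integral_add g) auto
  also have "Gamma (6 :: real) = 120" using Gamma_fact[of 5, where ?'a = real] by (simp add: fact_numeral)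
  also have "Gamma (real n) = fact (n - 1)"
    using Gamma_fact[of "n - 1", where ?'a = real] assms by (simp add: of_nat_diff)
  also have "fact (n - 1) \<le> (fact n :: real)" by (intro fact_mono) simp
  also have "120 + fact n \<le> (121 * fact n :: real)"
    using fact_ge_1[of n, where ?'a = real] by simp
  finally show ?thesis by simp
qed

text \<open>The bound ln n \<le> 2 n^(1/2) costs half a power in n! \<le> exp(n ln n). With n of
  size |w|^(1/2) the exponent 3/2 becomes 3/4, which is still below 1.\<close>

lemma fact_le_exp:
  assumes "n \<ge> 1"
  shows "fact n \<le> exp (2 * real n powr (3 / 2))"
proof -
  have n: "real n \<ge> 1" using assms by simp
  have "fact n \<le> real n ^ n" using fact_le_power[of n, where ?'a = real] by simp
  also have "\<dots> = exp (real n * ln (real n))"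
    using n by (simp add: exp_of_nat_mult)
  also have "real n * ln (real n) \<le> real n * (2 * real n powr (1 / 2))"
    using ln_powr_bound[of "real n" "1 / 2"] n by (intro mult_left_mono) auto
  also have "real n * (2 * real n powr (1 / 2)) = 2 * real n powr (3 / 2)"
    using n powr_add[of "real n" 1 "1 / 2"] by simp
  finally show ?thesis by simp
qed

lemma xi_even_growth: "\<exists>C\<ge>0. \<forall>w. norm (xi_even w) \<le> exp (C * (1 + norm w) powr (3 / 4))"
proof (intro exI[of _ "2 * 16 powr (3 / 2) + 121"] conjI allI)
  fix w :: complex
  define R where "R = norm w"
  define r where "r = sqrt R"
  define n where "n = nat \<lceil>6 + r\<rceil>"
  have R: "R \<ge> 0" and r: "r \<ge> 0" by (simp_all add: R_def r_def)
  have n: "6 + r \<le> real n" "real n \<le> 7 + r" using r unfolding n_def by linarith+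
  have "norm (xi_even w) \<le> norm (xi_even (of_real R))" unfolding R_def by (rule xi_even_norm_le)
  also have "complex_of_real R = (of_real r)\<^sup>2"
    using R by (simp add: r_def flip: of_real_power)
  also have "norm (xi_even ((of_real r)\<^sup>2)) = norm (LINT t|lborel. complex_of_real (xi_kernel t * exp (r * t)))"
    unfolding xi_even_square by (simp add: exp_of_real[symmetric])
  also have "\<dots> = \<bar>LINT t|lborel. xi_kernel t * exp (r * t)\<bar>"
    by (simp only: integral_complex_of_real norm_of_real)
  also have "\<dots> = (LINT t|lborel. xi_kernel t * exp (r * t))"
    by (intro abs_of_nonneg integral_nonneg_AE) auto
  also have "\<dots> \<le> (LINT t|lborel. exp ((6 + r) * t - exp t))"
    by (rule xi_kernel_exp_integrable_nonneg(2)[OF r])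
  also have "\<dots> \<le> 121 * fact n" by (rule gamma_integral_bound[OF r n(1)])
  also have "\<dots> \<le> exp 121 * exp (2 * real n powr (3 / 2))"
    using n r exp_ge_add_one_self[of 121] by (intro mult_mono fact_le_exp) auto
  also have "\<dots> = exp (121 + 2 * real n powr (3 / 2))" by (simp add: exp_add)
  also have "\<dots> \<le> exp ((2 * 16 powr (3 / 2) + 121) * (1 + R) powr (3 / 4))"
  proof -
    \<comment> \<open>These give 7 + r \<le> 8 sqrt(1 + R), so 16 leaves room.\<close>
    have "1 \<le> sqrt (1 + R)" "r \<le> sqrt (1 + R)" using R by (simp_all add: r_def)
    then have "real n \<le> 16 * sqrt (1 + R)" using n(2) by linarith
    then have "real n powr (3 / 2) \<le> (16 * sqrt (1 + R)) powr (3 / 2)"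
      by (intro powr_mono2) auto
    also have "\<dots> = 16 powr (3 / 2) * (1 + R) powr (3 / 4)"
      using R by (simp add: powr_mult powr_half_sqrt[symmetric] powr_powr)
    finally have "real n powr (3 / 2) \<le> 16 powr (3 / 2) * (1 + R) powr (3 / 4)" .
    moreover have "1 \<le> (1 + R) powr (3 / 4)" using R by (intro ge_one_powr_ge_zero) auto
    ultimately show ?thesis by (simp add: distrib_right)
  qed
  finally show "norm (xi_even w) \<le> exp ((2 * 16 powr (3 / 2) + 121) * (1 + norm w) powr (3 / 4))"
    by (simp add: R_def)
qed simp

text \<open>For each t the terms sum to \<Delta>(i exp t) exp(s t), which is the kernel times exp((s
  - 6) t): the shift by 6 centres the Laplace transform. Absolute convergence of the Dirichlet
  series at \<open>Re s\<close> justifies the exchange of sum and integral.\<close>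

theorem xi_even_mellin:
  assumes s: "Re s > 13 / 2"
  shows "(\<lambda>n. of_int (ramanujan_tau (Suc n)) * (of_real (2 * pi * real (Suc n)) powr (- s) * Gamma s))
    sums xi_even ((s - 6)\<^sup>2)"
proof -
  let ?t = "\<lambda>n. complex_of_int (ramanujan_tau (Suc n))"
  let ?c = "\<lambda>n. 2 * pi * real (Suc n)"
  let ?f = "\<lambda>n t. ?t n * (exp (s * of_real t) * complex_of_real (exp (- (?c n * exp t))))"
  define \<sigma> where "\<sigma> = Re s"
  have \<sigma>: "\<sigma> > 13 / 2" using s by (simp add: \<sigma>_def)
  have c: "?c n > 0" for n by simp
  have i: "has_bochner_integral lborel (?f n) (?t n * (of_real (?c n) powr (- s) * Gamma s))" for n
    by (intro has_bochner_integral_mult_right gamma_integral_exp c) (use s in linarith)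
  have int: "integrable lborel (?f n)" for n using i[of n] by (rule integrable.intros)
  have nf: "norm (?f n t) = \<bar>real_of_int (ramanujan_tau (Suc n))\<bar> * exp (\<sigma> * t - ?c n * exp t)" for n t
  proof -
    have "norm (exp (s * of_real t)) * norm (complex_of_real (exp (- u))) = exp (\<sigma> * t - u)" for u
      by (simp add: norm_exp_eq_Re \<sigma>_def flip: exp_add)
    moreover have "norm (?t n) = \<bar>real_of_int (ramanujan_tau (Suc n))\<bar>" by simp
    ultimately show ?thesis unfolding norm_mult by (simp only:)
  qed
  have "(LINT t|lborel. norm (?f n t)) = \<bar>real_of_int (ramanujan_tau (Suc n))\<bar> * (?c n powr (- \<sigma>) * Gamma \<sigma>)" for n
    unfolding nf by (intro has_bochner_integral_integral_eq has_bochner_integral_mult_right gamma_integral_exp_real c)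
      (use \<sigma> in linarith)
  moreover have "?c n powr (- \<sigma>) = (2 * pi) powr (- \<sigma>) * real (Suc n) powr (- \<sigma>)" for n
    by (rule powr_mult)
  ultimately have "(LINT t|lborel. norm (?f n t)) =
     \<bar>real_of_int (ramanujan_tau (Suc n))\<bar> * real (Suc n) powr (- \<sigma>) * ((2 * pi) powr (- \<sigma>) * Gamma \<sigma>)" for n
    by (simp only: mult_ac)
  then have sm: "summable (\<lambda>n. LINT t|lborel. norm (?f n t))"
    using summable_mult2[OF ramanujan_tau_dirichlet_summable[OF \<sigma>]] by (simp only:)
  have q: "norm (exp (2 * of_real pi * \<i> * (\<i> * of_real (exp t)))) < 1" for t
    unfolding nome_norm by simp
  have f: "?f n t = ?t n * exp (2 * of_real pi * \<i> * (\<i> * of_real (exp t))) ^ n *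
      (exp (2 * of_real pi * \<i> * (\<i> * of_real (exp t))) * exp (s * of_real t))" for n t
  proof -
    have "2 * of_real pi * \<i> * (\<i> * of_real (exp t)) = complex_of_real (- (2 * pi * exp t))"
      by (simp add: complex_eq_iff)
    then have e: "exp (2 * of_real pi * \<i> * (\<i> * of_real (exp t))) = complex_of_real (exp (- (2 * pi * exp t)))"
      by (simp only: exp_of_real)
    have "exp (- (?c n * exp t)) = exp (real (Suc n) * (- (2 * pi * exp t)))" by (simp add: algebra_simps)
    also have "\<dots> = exp (- (2 * pi * exp t)) ^ n * exp (- (2 * pi * exp t))"
      unfolding exp_of_nat_mult by simp
    finally show ?thesis unfolding e by simp
  qed
  have fs: "(\<lambda>n. ?f n t) sums (of_real (xi_kernel t) * exp ((s - 6) * of_real t))" for t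
  proof -
    have "disc (\<i> * of_real (exp t)) * exp (s * of_real t) = of_real (xi_kernel t) * exp ((s - 6) * of_real t)"
      by (simp add: disc_xi_kernel[symmetric] left_diff_distrib exp_diff)
    then show ?thesis
      using sums_mult2[OF ramanujan_tau_sums[OF q[of t]], of "exp (2 * of_real pi * \<i> * (\<i> * of_real (exp t))) * exp (s * of_real t)"]
      unfolding f disc_def by (simp only: mult_ac)
  qed
  have ae: "AE t in lborel. summable (\<lambda>n. norm (?f n t))"
  proof (intro AE_I2)
    fix t
    have "norm (exp (2 * of_real pi * \<i> * (\<i> * of_real (exp t)))) \<ge> 0" by simp
    from summable_mult2[OF ramanujan_tau_abs_summable[OF this q[of t]]]
    show "summable (\<lambda>n. norm (?f n t))" unfolding f norm_mult norm_power .
  qed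
  have eq: "(\<Sum>n. ?f n t) = of_real (xi_kernel t) * exp ((s - 6) * of_real t)" for t
    using sums_unique[OF fs] by simp
  show ?thesis
    using sums_integral[OF int ae sm]
    unfolding eq has_bochner_integral_integral_eq[OF i] xi_even_square .
qed

section \<open>Identification of the zeta function\<close>

definition xi_entire :: "complex \<Rightarrow> complex" where
  "xi_entire s = xi_even ((s - 6)\<^sup>2)"

text \<open>The factor \<open>rGamma\<close> is entire, so this candidate for the continuation needs
  no discussion of poles.\<close>

definition zeta_entire :: "complex \<Rightarrow> complex" where
  "zeta_entire s = xi_entire s * of_real (2 * pi) powr s * rGamma s"

lemma xi_entire_holomorphic: "xi_entire holomorphic_on UNIV"
  unfolding xi_entire_def
  by (rule holomorphic_on_compose_gen[OF _ xi_even_holomorphic, unfolded o_def]) (auto intro!: holomorphic_intros)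

lemma zeta_entire_holomorphic: "zeta_entire holomorphic_on UNIV"
  unfolding zeta_entire_def by (intro holomorphic_intros xi_entire_holomorphic)

lemma zeta_entire_eq_series:
  assumes s: "Re s > 13 / 2"
  shows "zeta_entire s = (\<Sum>l. of_int (ramanujan_tau (Suc l)) * of_nat (Suc l) powr (- s))"
proof -
  let ?P = "complex_of_real (2 * pi)"
  have G: "Gamma s * rGamma s = 1"
  proof -
    have "s \<notin> \<int>\<^sub>\<le>\<^sub>0" using s by (auto elim!: nonpos_Ints_cases)
    then show ?thesis by (simp add: Gamma_def rGamma_eq_zero_iff)
  qed
  have P: "?P powr (- s) * ?P powr s = 1"
    by (simp add: powr_minus)
  \<comment> \<open>The complex power of the product splits because both factors are nonnegative
    reals.\<close>
  have split: "complex_of_real (2 * pi * real (Suc n)) powr (- s) = ?P powr (- s) * of_nat (Suc n) powr (- s)" for n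
  proof -
    have "complex_of_real (2 * pi * real (Suc n)) powr (- s) = (?P * complex_of_real (real (Suc n))) powr (- s)"
      by (simp only: of_real_mult)
    also have "\<dots> = ?P powr (- s) * complex_of_real (real (Suc n)) powr (- s)"
      by (rule powr_times_real) auto
    finally show ?thesis by (simp only: of_real_of_nat_eq)
  qed
  have "(\<lambda>n. of_int (ramanujan_tau (Suc n)) * (complex_of_real (2 * pi * real (Suc n)) powr (- s) * Gamma s)
      * (?P powr s * rGamma s)) sums (xi_entire s * (?P powr s * rGamma s))"
    unfolding xi_entire_def by (intro sums_mult2 xi_even_mellin s)
  moreover have "of_int (ramanujan_tau (Suc n)) * (complex_of_real (2 * pi * real (Suc n)) powr (- s) * Gamma s)
      * (?P powr s * rGamma s) = of_int (ramanujan_tau (Suc n)) * of_nat (Suc n) powr (- s)" for n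
  proof -
    have "a * (p * b * g) * (p' * r) = a * b * (p * p') * (g * r)" for a b p p' g r :: complex
      by (simp only: mult_ac)
    then show ?thesis unfolding split by (simp only: G P mult_1_right)
  qed
  ultimately have "(\<lambda>n. of_int (ramanujan_tau (Suc n)) * of_nat (Suc n) powr (- s)) sums zeta_entire s"
    by (simp only: zeta_entire_def mult.assoc)
  then show ?thesis by (rule sums_unique)
qed

text \<open>The definite description needs existence, given by \<open>zeta_entire\<close>, and
  uniqueness, given by the identity theorem on the half plane Re x > 13/2.\<close>

lemma ramanujan_zeta_eq: "ramanujan_zeta = zeta_entire"
  unfolding ramanujan_zeta_def
proof (rule the_equality)
  fix H assume H: "H holomorphic_on UNIV \<and> (\<forall>x. Re x > 13 / 2 \<longrightarrow>
        H x = (\<Sum>l. of_int (ramanujan_tau (Suc l)) * of_nat (Suc l) powr (- x)))"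
  show "H = zeta_entire"
  proof
    fix z
    show "H z = zeta_entire z"
    proof (rule analytic_continuation_open[of "{x. Re x > 13 / 2}" UNIV H zeta_entire])
      show "open {x. Re x > 13 / 2}" by (rule open_halfspace_Re_gt)
      show "{x. Re x > 13 / 2} \<noteq> {}" by (auto intro!: exI[of _ 7])
      show "H x = zeta_entire x" if "x \<in> {x. Re x > 13 / 2}" for x
        using H zeta_entire_eq_series[of x] that by simp
    qed (use H zeta_entire_holomorphic in auto)
  qed
qed (use zeta_entire_holomorphic zeta_entire_eq_series in auto)

lemma ramanujan_rankin_eq: "ramanujan_rankin = xi_entire"
  unfolding ramanujan_rankin_def ramanujan_zeta_eq
proof (rule the_equality)
  have eq: "of_real (2 * pi) powr (- x) * Gamma x * zeta_entire x = xi_entire x" if "x \<notin> \<int>\<^sub>\<le>\<^sub>0" for x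
  proof -
    have "Gamma x * rGamma x = 1"
      using that by (simp add: Gamma_def rGamma_eq_zero_iff)
    moreover have "complex_of_real (2 * pi) powr (- x) * of_real (2 * pi) powr x = 1"
      by (simp add: powr_minus)
    moreover have "p * g * (X * p' * r) = X * (p * p') * (g * r)" for p g X p' r :: complex
      by (simp only: mult_ac)
    ultimately show ?thesis unfolding zeta_entire_def by (simp only: mult_1_right)
  qed
  then show "xi_entire holomorphic_on UNIV \<and> (\<forall>x. x \<notin> \<int>\<^sub>\<le>\<^sub>0 \<longrightarrow>
        xi_entire x = of_real (2 * pi) powr (- x) * Gamma x * zeta_entire x)"
    using xi_entire_holomorphic by auto
  fix f assume f: "f holomorphic_on UNIV \<and> (\<forall>x. x \<notin> \<int>\<^sub>\<le>\<^sub>0 \<longrightarrow>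
        f x = of_real (2 * pi) powr (- x) * Gamma x * zeta_entire x)"
  have pos: "x \<notin> \<int>\<^sub>\<le>\<^sub>0" if "Re x > 0" for x :: complex
    using that by (auto elim!: nonpos_Ints_cases)
  show "f = xi_entire"
  proof
    fix z
    show "f z = xi_entire z"
    \<comment> \<open>Uniqueness is decided on Re x > 0, which avoids the poles of Gamma.\<close>
    proof (rule analytic_continuation_open[of "{x. Re x > 0}" UNIV f xi_entire])
      show "open {x. Re x > 0}" by (rule open_halfspace_Re_gt)
      show "{x. Re x > 0} \<noteq> {}" by (auto intro!: exI[of _ 1])
      show "f x = xi_entire x" if "x \<in> {x. Re x > 0}" for x
        using f eq[of x] pos[of x] that by simp
    qed (use f xi_entire_holomorphic in auto)
  qed
qed

theorem theorem2:
  fixes z :: complex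
  shows "\<exists>p. has_prod_over (\<lambda>(w, k). 1 - z\<^sup>2 / w\<^sup>2) p (upper_zeros ramanujan_de_bruijn) \<and>
             ramanujan_de_bruijn z = ramanujan_de_bruijn 0 * p"
proof -
  have X: "ramanujan_de_bruijn = (\<lambda>z. xi_even (z\<^sup>2))"
    by (simp add: fun_eq_iff ramanujan_de_bruijn_def ramanujan_rankin_eq xi_entire_def)
  obtain C where C: "C \<ge> 0" "\<And>w. norm (xi_even w) \<le> exp (C * (1 + norm w) powr (3 / 4))"
    using xi_even_growth by blast
  have nz: "xi_even 0 \<noteq> 0" using xi_even_nonneg_real[of 0] by simp
  interpret genus_zero xi_even C "3 / 4"
    by standard (use xi_even_holomorphic nz C in auto)
  have "has_prod_over (\<lambda>(w, k). 1 - z\<^sup>2 / w\<^sup>2) (xi_even (z\<^sup>2) / xi_even 0) (upper_zeros (\<lambda>z. xi_even (z\<^sup>2)))"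
  proof (rule hadamard_product_even)
    fix x :: complex assume "x \<in> \<real>"
    then obtain r where "x = of_real r" by (auto elim: Reals_cases)
    then show "xi_even (x\<^sup>2) \<noteq> 0" using xi_even_nonneg_real[of "r\<^sup>2"] by simp
  qed
  then show ?thesis unfolding X using nz by (intro exI[of _ "xi_even (z\<^sup>2) / xi_even 0"]) auto
qed

end
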